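(* Let $F$ be the fork graph with vertex set $\{u,v,w,x,y\}$ and edge set $\{uv, vw, wx, wy\}$. For an integer $k\ge 1$, let $F^{(k)}_w$ be the graph obtained from $F$ by replacing the vertex $w$ by a complete graph $K_{k+1}$ on new vertices $w_0,\dots,w_k$, each of which is adjacent to $v$, $x$ and $y$ (and to each other). Then for any $k\geq 1$, \begin{align*} X_{F^{(k)}_w}=&\, (k + 1)! s_{(3,2,1^k)} + (k + 3) (k + 1)! s_{(3,1^{k+2})} -2(k + 1)! s_{(2^3,1^{k-1})} \\ &+ 5(k + 1)(k + 1)! s_{(2^2,1^{k+1})} + (k^{3} + 5 k^{2} + 14 k + 14) (k + 1)! s_{(2,1^{k+3})} \\ &+ 2 (k + 2)^{3} (k + 1)! s_{(1^{k+5})}. \end{align*} In particular, $X_{F^{(k)}_w}$ is not $s$-positive.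
   Context: For a finite simple graph $G$ with vertex set $\{v_1,\dots,v_d\}$, the chromatic symmetric function is $X_G=\sum_{\kappa} x_{\kappa(v_1)}\cdots x_{\kappa(v_d)}$, summed over all proper colorings $\kappa:V(G)\to\{1,2,\dots\}$, with commuting indeterminates. $s_\lambda$ denotes the Schur function indexed by the partition $\lambda$; $G$ is $s$-positive if all coefficients of $X_G$ in the Schur basis are non-negative. Partition notation: $(a^{m},b^{n},\dots)$ has $m$ parts equal to $a$, $n$ parts equal to $b$, etc.; e.g. $(2^3,1^{k-1})$ has three parts $2$ and $k-1$ parts $1$ (for $k=1$ this is $(2,2,2)$). *)

theory Defs
  imports Complex_Main "HOL-Library.Multiset" "HOL-Library.FuncSet"
begin

type_synonym 'a ugraph = "'a set \<times> 'a set set"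

definition verts :: "'a ugraph \<Rightarrow> 'a set" where
  "verts G = fst G"

definition edges :: "'a ugraph \<Rightarrow> 'a set set" where
  "edges G = snd G"

definition finite_simple_graph :: "'a ugraph \<Rightarrow> bool" where
  "finite_simple_graph G \<longleftrightarrow>
     finite (verts G) \<and>
     (\<forall>e\<in>edges G. \<exists>a\<in>verts G. \<exists>b\<in>verts G. a \<noteq> b \<and> e = {a, b})"

datatype fork_vertex = fork_u | fork_v | fork_w | fork_x | fork_y

definition fork_graph :: "fork_vertex ugraph" where
  "fork_graph =
     ({fork_u, fork_v, fork_w, fork_x, fork_y},
      {{fork_u, fork_v}, {fork_v, fork_w}, {fork_w, fork_x}, {fork_w, fork_y}})"

text \<open>
  Replacement of the vertex \<open>w\<close> by a complete graph on \<open>k + 1\<close> new vertices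
  \<open>Inr 0, \<dots>, Inr k\<close>; the old vertices \<open>a \<noteq> w\<close> are kept as \<open>Inl a\<close>.
\<close>

definition replace_by_clique :: "'a ugraph \<Rightarrow> 'a \<Rightarrow> nat \<Rightarrow> ('a + nat) ugraph" where
  "replace_by_clique G w k =
     (Inl ` (verts G - {w}) \<union> Inr ` {..k},
      {{Inl a, Inl b} | a b. {a, b} \<in> edges G \<and> a \<noteq> w \<and> b \<noteq> w}
      \<union> {{Inl a, Inr i} | a i. {a, w} \<in> edges G \<and> a \<noteq> w \<and> i \<le> k}
      \<union> {{Inr i, Inr j} | i j. i \<le> k \<and> j \<le> k \<and> i \<noteq> j})"

lemma finite_simple_graph_replace_by_clique:
  assumes "finite_simple_graph G"
  shows "finite_simple_graph (replace_by_clique G w k)"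
proof -
  have adj: "a \<in> verts G \<and> b \<in> verts G \<and> a \<noteq> b" if "{a, b} \<in> edges G" for a b
    using assms that unfolding finite_simple_graph_def
    by (metis doubleton_eq_iff)
  have fin: "finite (verts (replace_by_clique G w k))"
    using assms by (simp add: finite_simple_graph_def replace_by_clique_def verts_def)
  show ?thesis
    unfolding finite_simple_graph_def
  proof (intro conjI ballI fin)
    fix e assume "e \<in> edges (replace_by_clique G w k)"
    then consider
        (old) a b where "e = {Inl a, Inl b}" "{a, b} \<in> edges G" "a \<noteq> w" "b \<noteq> w"
      | (mixed) a i where "e = {Inl a, Inr i}" "{a, w} \<in> edges G" "a \<noteq> w" "i \<le> k"
      | (new) i j where "e = {Inr i, Inr j}" "i \<le> k" "j \<le> k" "i \<noteq> j"
      by (auto simp: replace_by_clique_def edges_def)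
    then show "\<exists>a\<in>verts (replace_by_clique G w k). \<exists>b\<in>verts (replace_by_clique G w k).
                 a \<noteq> b \<and> e = {a, b}"
    proof cases
      case old
      with adj[of a b] show ?thesis
        by (intro bexI[of _ "Inl a"] bexI[of _ "Inl b"])
          (auto simp: replace_by_clique_def verts_def)
    next
      case mixed
      with adj[of a w] show ?thesis
        by (intro bexI[of _ "Inl a"] bexI[of _ "Inr i"])
          (auto simp: replace_by_clique_def verts_def)
    next
      case new
      then show ?thesis
        by (intro bexI[of _ "Inr i"] bexI[of _ "Inr j"])
          (auto simp: replace_by_clique_def verts_def)
    qed
  qed
qed

lemma finite_simple_graph_fork: "finite_simple_graph fork_graph"
  by (auto simp: finite_simple_graph_def fork_graph_def verts_def edges_def)

text \<open>
  A formal power series in the commuting indeterminates \<open>x\<^sub>1, x\<^sub>2, \<dots>\<close> is given by its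
  coefficients; the multiset \<open>{#i\<^sub>1, \<dots>, i\<^sub>d#}\<close> stands for the monomial
  \<open>x\<^bsub>i\<^sub>1\<^esub> \<cdots> x\<^bsub>i\<^sub>d\<^esub>\<close>.
\<close>

type_synonym power_series = "nat multiset \<Rightarrow> rat"

text \<open>Colorings and tableaux are extensional functions, so that each is counted once.\<close>

definition proper_coloring :: "'a ugraph \<Rightarrow> ('a \<Rightarrow> nat) \<Rightarrow> bool" where
  "proper_coloring G \<kappa> \<longleftrightarrow>
     \<kappa> \<in> verts G \<rightarrow>\<^sub>E {1..} \<and> (\<forall>a b. {a, b} \<in> edges G \<longrightarrow> \<kappa> a \<noteq> \<kappa> b)"

definition chromatic_sym :: "'a ugraph \<Rightarrow> power_series" where
  "chromatic_sym G = (\<lambda>m.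
     of_nat (card {\<kappa>. proper_coloring G \<kappa> \<and> image_mset \<kappa> (mset_set (verts G)) = m}))"

definition is_partition :: "nat list \<Rightarrow> bool" where
  "is_partition \<mu> \<longleftrightarrow> sorted_wrt (\<ge>) \<mu> \<and> (\<forall>p\<in>set \<mu>. p \<ge> 1)"

definition young_diagram :: "nat list \<Rightarrow> (nat \<times> nat) set" where
  "young_diagram \<mu> = {(i, j). i < length \<mu> \<and> j < \<mu> ! i}"

definition semistandard_tableau :: "nat list \<Rightarrow> (nat \<times> nat \<Rightarrow> nat) \<Rightarrow> bool" where
  "semistandard_tableau \<mu> T \<longleftrightarrow>
     T \<in> young_diagram \<mu> \<rightarrow>\<^sub>E {1..} \<and>
     (\<forall>i j j'. (i, j) \<in> young_diagram \<mu> \<and> (i, j') \<in> young_diagram \<mu> \<and> j < j'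
        \<longrightarrow> T (i, j) \<le> T (i, j')) \<and>
     (\<forall>i i' j. (i, j) \<in> young_diagram \<mu> \<and> (i', j) \<in> young_diagram \<mu> \<and> i < i'
        \<longrightarrow> T (i, j) < T (i', j))"

definition schur :: "nat list \<Rightarrow> power_series" where
  "schur \<mu> = (\<lambda>m.
     of_nat (card {T. semistandard_tableau \<mu> T \<and> image_mset T (mset_set (young_diagram \<mu>)) = m}))"

definition schur_expansion :: "(nat list \<Rightarrow> rat) \<Rightarrow> power_series \<Rightarrow> bool" where
  "schur_expansion c f \<longleftrightarrow>
     finite {\<mu>. c \<mu> \<noteq> 0} \<and> (\<forall>\<mu>. c \<mu> \<noteq> 0 \<longrightarrow> is_partition \<mu>) \<and>
     f = (\<lambda>m. \<Sum>\<mu> | c \<mu> \<noteq> 0. c \<mu> * schur \<mu> m)"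

text \<open>
  The Schur functions being linearly independent, the coefficient family \<open>c\<close> below is the
  only one that can occur.
\<close>

definition schur_positive :: "power_series \<Rightarrow> bool" where
  "schur_positive f \<longleftrightarrow> (\<exists>c. schur_expansion c f \<and> (\<forall>\<mu>. c \<mu> \<ge> 0))"

end

theory Submission
  imports Defs "HOL-Combinatorics.Permutations" "HOL-Library.Disjoint_Sets"
begin

text \<open>
  Deleting the cells with the largest entry of a semistandard tableau removes a horizontal strip,
  which shortens each column by at most one cell. The alternating sum
  \<open>\<Sum>\<^sub>p sign p e\<^bsub>a (p 0) - p 0\<^esub> e\<^bsub>a (p 1) - p 1 + 1\<^esub> \<cdots>\<close> obeys the same recursion, because it vanishes
  whenever shortening makes the column lengths \<open>a\<close> non-dominant. This is the dual Jacobi--Trudi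
  formula, and it expresses the six Schur functions of the theorem by products of at most three
  elementary symmetric functions.

  On the other side, Stanley's description of the coefficients of \<open>X\<^sub>G\<close> by stable partitions, whose
  blocks of size at least two can be listed for \<open>G = F\<^sub>w\<^sup>(\<^sup>k\<^sup>)\<close>, gives
  \<open>X\<^sub>G = (k+1)! (e\<^bsub>k+2\<^esub>e\<^sub>2e\<^sub>1 - 3e\<^bsub>k+2\<^esub>e\<^sub>3 + (k+2)e\<^bsub>k+3\<^esub>e\<^sub>1e\<^sub>1 + 4(k+1)e\<^bsub>k+3\<^esub>e\<^sub>2 +
  (k\<^sup>3+5k\<^sup>2+8k+7)e\<^bsub>k+4\<^esub>e\<^sub>1 + (k+1)\<^sup>2(k+5)e\<^bsub>k+5\<^esub>)\<close>. Comparing the two expansions yields the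
  formula, and since the Schur functions are linearly independent, its negative coefficient
  excludes \<open>s\<close>-positivity.
\<close>

section \<open>Deleting the largest value of a tableau\<close>

abbreviation content :: "('a \<Rightarrow> 'b) \<Rightarrow> 'a set \<Rightarrow> 'b multiset" where
  "content f D \<equiv> image_mset f (mset_set D)"

definition semistandard_on :: "(nat \<times> nat) set \<Rightarrow> (nat \<times> nat \<Rightarrow> 'v :: linorder) \<Rightarrow> bool" where
  "semistandard_on D T \<longleftrightarrow>
     (\<forall>i j j'. (i, j) \<in> D \<and> (i, j') \<in> D \<and> j < j' \<longrightarrow> T (i, j) \<le> T (i, j')) \<and>
     (\<forall>i i' j. (i, j) \<in> D \<and> (i', j) \<in> D \<and> i < i' \<longrightarrow> T (i, j) < T (i', j))"

definition ssyt :: "(nat \<times> nat) set \<Rightarrow> 'v :: linorder multiset \<Rightarrow> (nat \<times> nat \<Rightarrow> 'v) set" where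
  "ssyt D m = {T \<in> extensional D. semistandard_on D T \<and> content T D = m}"

lemma ssyt_row_mono:
  "T \<in> ssyt D m \<Longrightarrow> (i, j) \<in> D \<Longrightarrow> (i, j') \<in> D \<Longrightarrow> j < j' \<Longrightarrow> T (i, j) \<le> T (i, j')"
  unfolding ssyt_def semistandard_on_def by blast

lemma ssyt_column_strict_mono:
  "T \<in> ssyt D m \<Longrightarrow> (i, j) \<in> D \<Longrightarrow> (i', j) \<in> D \<Longrightarrow> i < i' \<Longrightarrow> T (i, j) < T (i', j)"
  unfolding ssyt_def semistandard_on_def by blast

lemma ssyt_value_mem:
  assumes "finite D" "T \<in> ssyt D m" "z \<in> D"
  shows "T z \<in># m"
  using assms by (auto simp: ssyt_def)

lemma finite_ssyt:
  assumes "finite D"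
  shows "finite (ssyt D m)"
proof (rule finite_subset)
  show "ssyt D m \<subseteq> D \<rightarrow>\<^sub>E set_mset m"
    using ssyt_value_mem[OF assms, of _ m] by (auto simp: ssyt_def PiE_def)
  show "finite (D \<rightarrow>\<^sub>E set_mset m)"
    using assms by (intro finite_PiE) auto
qed

lemma content_Diff:
  assumes "finite D" "S \<subseteq> D"
  shows "content f D = content f (D - S) + content f S"
  using assms mset_set_Union[of "D - S" S] finite_subset[OF assms(2,1)]
  by (metis Diff_disjoint Diff_partition finite_Diff image_mset_union inf_commute sup_commute)

lemma content_cong:
  "(\<And>z. z \<in> D \<Longrightarrow> f z = g z) \<Longrightarrow> content f D = content g D"
  by (cases "finite D") (auto intro: image_mset_cong)

lemma content_eq_replicate_mset:
  "(\<And>z. z \<in> D \<Longrightarrow> f z = c) \<Longrightarrow> content f D = replicate_mset (card D) c"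
  by (subst content_cong[of D f "\<lambda>_. c"]) (simp_all add: image_mset_const_eq)

text \<open>The sets of \<open>x\<close> cells that can be occupied by the largest value of a tableau on \<open>D\<close>.\<close>

definition top_strips :: "(nat \<times> nat) set \<Rightarrow> nat \<Rightarrow> (nat \<times> nat) set set" where
  "top_strips D x = {S. S \<subseteq> D \<and> card S = x \<and>
     (\<forall>i j j'. (i, j) \<in> S \<and> (i, j') \<in> D \<and> j < j' \<longrightarrow> (i, j') \<in> S) \<and>
     (\<forall>i i' j. (i, j) \<in> S \<and> (i', j) \<in> D \<longrightarrow> i' \<le> i)}"

lemma top_stripsD:
  assumes "S \<in> top_strips D x"
  shows "S \<subseteq> D" "card S = x"
    and "\<And>i j j'. (i, j) \<in> S \<Longrightarrow> (i, j') \<in> D \<Longrightarrow> j < j' \<Longrightarrow> (i, j') \<in> S"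
    and "\<And>i i' j. (i, j) \<in> S \<Longrightarrow> (i', j) \<in> D \<Longrightarrow> i' \<le> i"
  using assms unfolding top_strips_def by blast+

lemma finite_top_strips: "finite D \<Longrightarrow> finite (top_strips D x)"
  by (rule finite_subset[of _ "Pow D"]) (auto simp: top_strips_def)

lemma ssyt_split_max:
  fixes M :: "'v :: linorder"
  assumes D: "finite D" and M: "\<And>v. v \<in># m \<Longrightarrow> v < M"
    and T: "T \<in> ssyt D (m + replicate_mset x M)" and S: "S = {z \<in> D. T z = M}"
  shows "S \<in> top_strips D x" "restrict T (D - S) \<in> ssyt (D - S) m"
proof -
  note row = ssyt_row_mono[OF T] and col = ssyt_column_strict_mono[OF T]
  have le_M: "T z \<le> M" if "z \<in> D" for z
    using ssyt_value_mem[OF D T that] M by (auto intro: less_imp_le split: if_splits)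
  have split: "content T (D - S) + replicate_mset (card S) M = m + replicate_mset x M"
    using T content_Diff[OF D, of S T] content_eq_replicate_mset[of S T M]
    by (auto simp: ssyt_def S)
  have "count (content T (D - S)) M = 0" "count m M = 0"
    using D M by (auto simp: S count_eq_zero_iff)
  then have card: "card S = x"
    using arg_cong[OF split, of "\<lambda>m. count m M"] by simp
  have "(i, j') \<in> S" if "(i, j) \<in> S" "(i, j') \<in> D" "j < j'" for i j j'
    using row[of i j j'] le_M[of "(i, j')"] that by (simp add: S)
  moreover have "i' \<le> i" if "(i, j) \<in> S" "(i', j) \<in> D" for i i' j
    using col[of i j i'] le_M[of "(i', j)"] that by (auto simp: S intro: leI)
  moreover have "S \<subseteq> D" by (simp add: S)
  ultimately show "S \<in> top_strips D x"
    using card unfolding top_strips_def by blast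
  have "content (restrict T (D - S)) (D - S) = content T (D - S)"
    by (rule content_cong) simp
  also have "\<dots> = m" using split card by simp
  finally show "restrict T (D - S) \<in> ssyt (D - S) m"
    using row col by (auto simp: ssyt_def semistandard_on_def)
qed

lemma ssyt_add_max:
  fixes M :: "'v :: linorder"
  assumes D: "finite D" and M: "\<And>v. v \<in># m \<Longrightarrow> v < M"
    and S: "S \<in> top_strips D x" and T: "T \<in> ssyt (D - S) m"
  defines "T' \<equiv> \<lambda>z. if z \<in> S then M else T z"
  shows "T' \<in> ssyt D (m + replicate_mset x M)" "{z \<in> D. T' z = M} = S" "restrict T' (D - S) = T"
proof -
  note strip = top_stripsD[OF S]
  have less_M: "T z < M" if "z \<in> D - S" for z
    using ssyt_value_mem[OF _ T that] D M by auto
  show "{z \<in> D. T' z = M} = S"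
    using strip(1) less_M by (auto simp: T'_def)
  show "restrict T' (D - S) = T"
    using T by (auto simp: T'_def ssyt_def extensional_def)
  have "content T' D = m + replicate_mset x M"
    using content_Diff[OF D strip(1), of T'] content_eq_replicate_mset[of S T' M] strip(2)
      content_cong[of "D - S" T' T] T
    by (simp add: T'_def ssyt_def)
  moreover have "T' \<in> extensional D"
    using T strip(1) by (auto simp: T'_def ssyt_def extensional_def)
  moreover have "T' (i, j) \<le> T' (i, j')" if "(i, j) \<in> D" "(i, j') \<in> D" "j < j'" for i j j'
    using ssyt_row_mono[OF T] that strip(3)[of i j j'] less_M[of "(i, j)"] by (auto simp: T'_def)
  moreover have "T' (i, j) < T' (i', j)" if "(i, j) \<in> D" "(i', j) \<in> D" "i < i'" for i i' j
    using ssyt_column_strict_mono[OF T] that strip(4)[of i j i'] less_M[of "(i, j)"]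
    by (auto simp: T'_def)
  ultimately show "T' \<in> ssyt D (m + replicate_mset x M)"
    unfolding ssyt_def semistandard_on_def by blast
qed

lemma card_ssyt_remove_max:
  fixes M :: "'v :: linorder"
  assumes D: "finite D" and M: "\<And>v. v \<in># m \<Longrightarrow> v < M"
  shows "card (ssyt D (m + replicate_mset x M)) = (\<Sum>S\<in>top_strips D x. card (ssyt (D - S) m))"
proof -
  let ?m = "m + replicate_mset x M"
  let ?split = "\<lambda>T. let S = {z \<in> D. T z = M} in (S, restrict T (D - S))"
  let ?join = "\<lambda>(S, T) z. if z \<in> S then M else T z"
  have "bij_betw ?split (ssyt D ?m) (SIGMA S:top_strips D x. ssyt (D - S) m)"
  proof (rule bij_betw_byWitness[where f' = ?join])
    show "\<forall>T\<in>ssyt D ?m. ?join (?split T) = T"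
      by (auto simp: ssyt_def extensional_def fun_eq_iff Let_def)
    show "?split ` ssyt D ?m \<subseteq> (SIGMA S:top_strips D x. ssyt (D - S) m)"
      using ssyt_split_max[OF D M] by (simp add: image_subset_iff Let_def)
    show "\<forall>p\<in>SIGMA S:top_strips D x. ssyt (D - S) m. ?split (?join p) = p"
      using ssyt_add_max(2,3)[OF D M] by (auto simp: Let_def)
    show "?join ` (SIGMA S:top_strips D x. ssyt (D - S) m) \<subseteq> ssyt D ?m"
      using ssyt_add_max(1)[OF D M] by auto
  qed
  then have "card (ssyt D ?m) = card (SIGMA S:top_strips D x. ssyt (D - S) m)"
    by (rule bij_betw_same_card)
  also have "\<dots> = (\<Sum>S\<in>top_strips D x. card (ssyt (D - S) m))"
    using D by (intro card_SigmaI finite_top_strips) (auto intro: finite_ssyt)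
  finally show ?thesis .
qed

section \<open>Diagrams with given column lengths\<close>

definition column_diagram :: "nat \<Rightarrow> (nat \<Rightarrow> int) \<Rightarrow> (nat \<times> nat) set" where
  "column_diagram n a = {(i, j). j < n \<and> int i < a j}"

definition column_lengths :: "nat \<Rightarrow> (nat \<Rightarrow> int) \<Rightarrow> bool" where
  "column_lengths n a \<longleftrightarrow> antimono_on {..<n} a \<and> (\<forall>j<n. 0 \<le> a j)"

definition shorten :: "(nat \<Rightarrow> int) \<Rightarrow> nat set \<Rightarrow> nat \<Rightarrow> int" where
  "shorten a J j = a j - of_bool (j \<in> J)"

lemma mem_column_diagram [simp]: "(i, j) \<in> column_diagram n a \<longleftrightarrow> j < n \<and> int i < a j"
  by (simp add: column_diagram_def)

lemma finite_column_diagram: "finite (column_diagram n a)"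
proof -
  have "column_diagram n a = (\<Union>j<n. {..<nat (a j)} \<times> {j})"
    by auto
  then show ?thesis by simp
qed

definition column_ends :: "(nat \<Rightarrow> int) \<Rightarrow> nat set \<Rightarrow> (nat \<times> nat) set" where
  "column_ends a J = (\<lambda>j. (nat (a j) - 1, j)) ` J"

lemma inj_column_ends: "inj (column_ends a)"
proof (rule injI)
  fix J J' assume "column_ends a J = column_ends a J'"
  then have "snd ` column_ends a J = snd ` column_ends a J'" by simp
  then show "J = J'" by (simp add: column_ends_def image_image)
qed

lemma card_column_ends: "card (column_ends a J) = card J"
  unfolding column_ends_def by (intro card_image inj_onI) simp

lemma column_diagram_minus_column_ends:
  "column_diagram n a - column_ends a J = column_diagram n (shorten a J)"
  by (auto simp: column_ends_def shorten_def image_iff split: split_of_bool_asm)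

lemma column_ends_mem_top_strips:
  assumes J: "J \<subseteq> {..<n}" and shortened: "column_lengths n (shorten a J)"
  shows "column_ends a J \<in> top_strips (column_diagram n a) (card J)"
proof -
  have pos: "a j > 0" if "j \<in> J" for j
    using shortened J that by (auto simp: column_lengths_def shorten_def)
  have "(i, j') \<in> column_ends a J" if "(i, j) \<in> column_ends a J" "j' < n" "int i < a j'" "j < j'"
    for i j j'
  proof -
    have i: "j \<in> J" "int i = a j - 1" using that(1) pos[of j] by (auto simp: column_ends_def)
    moreover have "shorten a J j' \<le> shorten a J j"
      using shortened J i(1) that(2,4) by (auto simp: column_lengths_def monotone_on_def)
    ultimately have "j' \<in> J" "int i = a j' - 1"
      using that(3) by (auto simp: shorten_def of_bool_def split: if_splits)
    then show ?thesis by (auto simp: column_ends_def image_iff)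
  qed
  moreover have "column_ends a J \<subseteq> column_diagram n a"
    using J pos by (fastforce simp: column_ends_def)
  moreover have "i' \<le> i" if "(i, j) \<in> column_ends a J" "(i', j) \<in> column_diagram n a" for i i' j
    using that by (auto simp: column_ends_def)
  ultimately show ?thesis
    unfolding top_strips_def by (auto simp: card_column_ends)
qed

lemma top_strip_eq_column_ends:
  assumes a: "column_lengths n a" and S: "S \<in> top_strips (column_diagram n a) x"
  obtains J where "J \<subseteq> {..<n}" "card J = x" "column_lengths n (shorten a J)" "S = column_ends a J"
proof
  note strip = top_stripsD[OF S]
  have bottom: "int i = a j - 1" if "(i, j) \<in> S" for i j
    using strip(1) strip(4)[OF that, of "nat (a j - 1)"] that by fastforce
  then have "(nat (a (snd z)) - 1, snd z) = z" if "z \<in> S" for z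
    using that by (cases z) force
  then show strip_eq: "S = column_ends a (snd ` S)"
    by (simp add: column_ends_def image_image)
  show "snd ` S \<subseteq> {..<n}" using strip(1) by auto
  show "card (snd ` S) = x"
    using strip(2) card_column_ends[of a "snd ` S"] by (simp flip: strip_eq)
  have "shorten a (snd ` S) j' \<le> shorten a (snd ` S) j" if "j < j'" "j' < n" for j j'
  proof (cases "j \<in> snd ` S \<and> a j' = a j")
    case True
    then obtain i where i: "(i, j) \<in> S" by auto
    then have "(i, j') \<in> column_diagram n a"
      using bottom[OF i] True that by simp
    then have "j' \<in> snd ` S"
      using strip(3)[OF i _ that(1)] by force
    then show ?thesis using True by (simp add: shorten_def)
  next
    case False
    moreover have "a j' \<le> a j" using a that by (auto simp: column_lengths_def monotone_on_def)
    ultimately show ?thesis by (auto simp: shorten_def)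
  qed
  moreover have "0 \<le> shorten a (snd ` S) j" if "j < n" for j
    using a that strip(1) by (force simp: column_lengths_def shorten_def)
  ultimately show "column_lengths n (shorten a (snd ` S))"
    unfolding column_lengths_def monotone_on_def by (metis lessThan_iff order.order_iff_strict)
qed

lemma card_ssyt_column_diagram_remove_max:
  fixes M :: "'v :: linorder"
  assumes a: "column_lengths n a" and M: "\<And>v. v \<in># m \<Longrightarrow> v < M"
  shows "card (ssyt (column_diagram n a) (m + replicate_mset x M))
    = (\<Sum>J | J \<subseteq> {..<n} \<and> card J = x \<and> column_lengths n (shorten a J).
         card (ssyt (column_diagram n (shorten a J)) m))"
proof -
  let ?D = "column_diagram n a"
  let ?\<J> = "{J. J \<subseteq> {..<n} \<and> card J = x \<and> column_lengths n (shorten a J)}"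
  have "top_strips ?D x = column_ends a ` ?\<J>"
  proof
    show "top_strips ?D x \<subseteq> column_ends a ` ?\<J>"
      using top_strip_eq_column_ends[OF a] by blast
    show "column_ends a ` ?\<J> \<subseteq> top_strips ?D x"
      using column_ends_mem_top_strips by blast
  qed
  then have "card (ssyt ?D (m + replicate_mset x M))
      = (\<Sum>S\<in>column_ends a ` ?\<J>. card (ssyt (?D - S) m))"
    using card_ssyt_remove_max[OF finite_column_diagram M] by simp
  also have "\<dots> = (\<Sum>J\<in>?\<J>. card (ssyt (column_diagram n (shorten a J)) m))"
    using inj_on_subset[OF inj_column_ends subset_UNIV]
    by (simp add: sum.reindex column_diagram_minus_column_ends)
  finally show ?thesis .
qed

section \<open>The dual Jacobi--Trudi formula\<close>

text \<open>
  The coefficient of the monomial \<open>m\<close> in the product \<open>e\<^bsub>a 0\<^esub> \<cdots> e\<^bsub>a (n - 1)\<^esub>\<close> of elementary symmetric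
  functions, where \<open>e\<^sub>r = 0\<close> for negative \<open>r\<close>.
\<close>

primrec elementary_coeff :: "nat \<Rightarrow> (nat \<Rightarrow> int) \<Rightarrow> 'v multiset \<Rightarrow> int" where
  "elementary_coeff 0 a m = of_bool (m = {#})"
| "elementary_coeff (Suc n) a m =
     (\<Sum>A | A \<subseteq> set_mset m \<and> int (card A) = a n. elementary_coeff n a (m - mset_set A))"

lemma elementary_coeff_cong:
  assumes "\<And>j. j < n \<Longrightarrow> a j = b j"
  shows "elementary_coeff n a m = elementary_coeff n b m"
  using assms
proof (induction n arbitrary: m)
  case (Suc n)
  then have "a n = b n" "elementary_coeff n a (m - mset_set A)
      = elementary_coeff n b (m - mset_set A)" for A
    by simp_all
  then show ?case by simp
qed simp

lemma elementary_coeff_empty: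
  "elementary_coeff n a ({#} :: 'v multiset) = of_bool (\<forall>j<n. a j = 0)"
proof (induction n)
  case (Suc n)
  have "{A :: 'v set. A \<subseteq> set_mset {#} \<and> int (card A) = a n} = (if a n = 0 then {{}} else {})"
    by auto
  then have "elementary_coeff (Suc n) a ({#} :: 'v multiset)
      = of_bool (a n = 0) * elementary_coeff n a ({#} :: 'v multiset)"
    by (simp only: elementary_coeff.simps) simp
  then show ?case using Suc by (auto simp: less_Suc_eq)
qed simp

lemma elementary_coeff_neg:
  assumes "j < n" "a j < 0"
  shows "elementary_coeff n a m = 0"
  using assms
proof (induction n arbitrary: m)
  case (Suc n)
  show ?case
  proof (cases "j = n")
    case True
    then have "{A. A \<subseteq> set_mset m \<and> int (card A) = a n} = {}"
      using Suc.prems(2) by auto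
    then show ?thesis by (simp only: elementary_coeff.simps sum.empty)
  qed (use Suc in simp)
qed simp

lemma sum_subsets_insert:
  assumes "finite F" "x \<notin> F"
  shows "(\<Sum>A | A \<subseteq> insert x F \<and> P A. f A)
    = (\<Sum>A | A \<subseteq> F \<and> P A. f A) + (\<Sum>A | A \<subseteq> F \<and> P (insert x A). f (insert x A))"
proof -
  have "{A. A \<subseteq> insert x F \<and> P A} = {A \<in> Pow (insert x F). P A}"
    by simp
  also have "\<dots> = {A. A \<subseteq> F \<and> P A} \<union> insert x ` {A. A \<subseteq> F \<and> P (insert x A)}"
    unfolding Pow_insert by auto
  finally have "(\<Sum>A | A \<subseteq> insert x F \<and> P A. f A)
      = (\<Sum>A | A \<subseteq> F \<and> P A. f A) + (\<Sum>A\<in>insert x ` {A. A \<subseteq> F \<and> P (insert x A)}. f A)"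
    using assms by (simp only:) (intro sum.union_disjoint; auto)
  moreover have "inj_on (insert x) {A. A \<subseteq> F \<and> P (insert x A)}"
    using assms(2) by (auto simp: inj_on_def)
  ultimately show ?thesis by (simp add: sum.reindex)
qed

lemma sum_subsets_card_insert:
  assumes "finite F" "x \<notin> F"
  shows "(\<Sum>A | A \<subseteq> insert x F \<and> int (card A) = c. f A)
    = (\<Sum>A | A \<subseteq> F \<and> int (card A) = c. f A)
    + (\<Sum>A | A \<subseteq> F \<and> int (card A) = c - 1. f (insert x A))"
proof -
  have "int (card (insert x A)) = c \<longleftrightarrow> int (card A) = c - 1" if "A \<subseteq> F" for A
    using assms that finite_subset[OF that] by (subst card_insert_disjoint) auto
  then have "{A. A \<subseteq> F \<and> int (card (insert x A)) = c} = {A. A \<subseteq> F \<and> int (card A) = c - 1}"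
    by blast
  then show ?thesis
    using sum_subsets_insert[OF assms, where P = "\<lambda>A. int (card A) = c"] by (simp only:)
qed

lemma add_diff_mset_set:
  assumes "A \<subseteq> set_mset m"
  shows "m + m' - mset_set A = m - mset_set A + m'"
proof -
  have "mset_set A \<subseteq># m"
    using assms by (auto simp: subseteq_mset_def count_mset_set')
  then show ?thesis by (metis subset_mset.add_diff_assoc2)
qed

lemma sum_elementary_coeff_shorten_Suc:
  fixes m :: "'v multiset" and n x :: nat and a :: "nat \<Rightarrow> int"
  defines "As \<equiv> \<lambda>c. {A. A \<subseteq> set_mset m \<and> int (card A) = c}"
    and "Js \<equiv> \<lambda>x. {J. J \<subseteq> {..<n} \<and> card J = x}"
    and "E \<equiv> \<lambda>J A. elementary_coeff n (shorten a J) (m - mset_set A)"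
  shows "(\<Sum>J | J \<subseteq> {..<Suc n} \<and> card J = Suc x. elementary_coeff (Suc n) (shorten a J) m)
    = (\<Sum>A\<in>As (a n). \<Sum>J\<in>Js (Suc x). E J A) + (\<Sum>A\<in>As (a n - 1). \<Sum>J\<in>Js x. E J A)"
proof -
  have "n \<notin> {..<n}" by simp
  note split = sum_subsets_card_insert[OF finite_lessThan this, where c = "int (Suc x)"]
  have card: "int (card J) = int (Suc x) - 1 \<longleftrightarrow> card J = x" for J :: "nat set"
    by auto
  have E_insert: "elementary_coeff n (shorten a (insert n J)) m'
      = elementary_coeff n (shorten a J) m'"
    for J and m' :: "'v multiset"
    by (rule elementary_coeff_cong) (simp add: shorten_def)
  have shorten_n: "shorten a (insert n J) n = a n - 1" "J \<in> Js y \<Longrightarrow> shorten a J n = a n" for J y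
    by (auto simp: shorten_def Js_def)
  have "(\<Sum>J | J \<subseteq> {..<Suc n} \<and> card J = Suc x. elementary_coeff (Suc n) (shorten a J) m)
      = (\<Sum>J\<in>Js (Suc x). elementary_coeff (Suc n) (shorten a J) m)
      + (\<Sum>J\<in>Js x. elementary_coeff (Suc n) (shorten a (insert n J)) m)"
    by (simp only: lessThan_Suc Js_def split[unfolded of_nat_eq_iff card])
  also have "\<dots> = (\<Sum>J\<in>Js (Suc x). \<Sum>A\<in>As (a n). E J A) + (\<Sum>J\<in>Js x. \<Sum>A\<in>As (a n - 1). E J A)"
    by (simp add: E_insert shorten_n As_def E_def)
  also have "\<dots> = (\<Sum>A\<in>As (a n). \<Sum>J\<in>Js (Suc x). E J A) + (\<Sum>A\<in>As (a n - 1). \<Sum>J\<in>Js x. E J A)"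
    by (rule arg_cong2[where f = "(+)"]; rule sum.swap)
  finally show ?thesis .
qed

lemma elementary_coeff_Suc_add_new:
  assumes M: "M \<notin># m"
  shows "elementary_coeff (Suc n) a (m + replicate_mset (Suc x) M)
    = (\<Sum>A | A \<subseteq> set_mset m \<and> int (card A) = a n.
         elementary_coeff n a (m - mset_set A + replicate_mset (Suc x) M))
    + (\<Sum>A | A \<subseteq> set_mset m \<and> int (card A) = a n - 1.
         elementary_coeff n a (m - mset_set A + replicate_mset x M))"
proof -
  have diff_insert: "m + replicate_mset (Suc x) M - mset_set (insert M A)
      = m - mset_set A + replicate_mset x M" if "A \<subseteq> set_mset m" for A
  proof -
    have "M \<notin> A" "finite A" using that M finite_subset by auto
    then have "m + replicate_mset (Suc x) M - mset_set (insert M A)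
        = m + replicate_mset x M - mset_set A"
      by simp
    then show ?thesis using that by (simp only: add_diff_mset_set)
  qed
  have "set_mset (m + replicate_mset (Suc x) M) = insert M (set_mset m)"
    by simp
  then show ?thesis
    using M by (simp add: sum_subsets_card_insert diff_insert add_diff_mset_set
        del: set_mset_union replicate_mset_Suc)
qed

lemma elementary_coeff_add_new:
  assumes "M \<notin># m"
  shows "elementary_coeff n a (m + replicate_mset x M)
    = (\<Sum>J | J \<subseteq> {..<n} \<and> card J = x. elementary_coeff n (shorten a J) m)"
  using assms
proof (induction n arbitrary: m x)
  case 0
  have "{J :: nat set. J \<subseteq> {..<0} \<and> card J = x} = (if x = 0 then {{}} else {})" by auto
  then show ?case by (simp only: elementary_coeff.simps) simp
next
  case (Suc n)
  show ?case
  proof (cases x)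
    case 0
    have "{J. J \<subseteq> {..<Suc n} \<and> card J = 0} = {{}}"
      by (auto dest: finite_subset)
    then show ?thesis using 0 by (simp add: shorten_def)
  next
    case x: (Suc y)
    have new: "M \<notin># m - mset_set A" for A
      using Suc.prems by (meson in_diffD)
    show ?thesis
      unfolding x sum_elementary_coeff_shorten_Suc elementary_coeff_Suc_add_new[OF Suc.prems]
      by (simp only: Suc.IH[OF new])
  qed
qed

definition jacobi_trudi :: "nat \<Rightarrow> (nat \<Rightarrow> int) \<Rightarrow> 'v multiset \<Rightarrow> int" where
  "jacobi_trudi n a m = (\<Sum>p | p permutes {..<n}.
     sign p * elementary_coeff n (\<lambda>j. a (p j) - int (p j) + int j) m)"

lemma sum_subsets_image_permutes:
  assumes "p permutes S"
  shows "(\<Sum>J | J \<subseteq> S \<and> card J = r. f (p ` J)) = (\<Sum>J | J \<subseteq> S \<and> card J = r. f J)"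
proof (rule sum.reindex_bij_betw, rule bij_betw_byWitness[where f' = "image (inv p)"])
  have maps: "(`) q ` {J. J \<subseteq> S \<and> card J = r} \<subseteq> {J. J \<subseteq> S \<and> card J = r}" if q: "q permutes S" for q
    using permutes_image[OF q] inj_on_subset[OF permutes_inj[OF q] subset_UNIV]
    by (auto simp: card_image)
  show "(`) p ` {J. J \<subseteq> S \<and> card J = r} \<subseteq> {J. J \<subseteq> S \<and> card J = r}"
    by (rule maps[OF assms])
  show "(`) (inv p) ` {J. J \<subseteq> S \<and> card J = r} \<subseteq> {J. J \<subseteq> S \<and> card J = r}"
    by (rule maps[OF permutes_inv[OF assms]])
qed (use permutes_inverses[OF assms] in \<open>simp_all add: image_image\<close>)

lemma jacobi_trudi_add_new:
  assumes "M \<notin># m"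
  shows "jacobi_trudi n a (m + replicate_mset x M)
    = (\<Sum>J | J \<subseteq> {..<n} \<and> card J = x. jacobi_trudi n (shorten a J) m)"
proof -
  let ?row = "\<lambda>a p j. a (p j) - int (p j) + int j"
  have "elementary_coeff n (?row a p) (m + replicate_mset x M)
      = (\<Sum>J | J \<subseteq> {..<n} \<and> card J = x. elementary_coeff n (?row (shorten a J) p) m)"
    if p: "p permutes {..<n}" for p
  proof -
    have "shorten (?row a p) J = ?row (shorten a (p ` J)) p" for J
      using permutes_inj[OF p] by (auto simp: shorten_def inj_image_mem_iff)
    then show ?thesis
      using elementary_coeff_add_new[OF assms]
        sum_subsets_image_permutes[OF p,
          where f = "\<lambda>J. elementary_coeff n (?row (shorten a J) p) m"]
      by simp
  qed
  then have "jacobi_trudi n a (m + replicate_mset x M) = (\<Sum>p | p permutes {..<n}.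
      \<Sum>J | J \<subseteq> {..<n} \<and> card J = x. sign p * elementary_coeff n (?row (shorten a J) p) m)"
    unfolding jacobi_trudi_def by (simp add: sum_distrib_left)
  also have "\<dots> = (\<Sum>J | J \<subseteq> {..<n} \<and> card J = x. jacobi_trudi n (shorten a J) m)"
    unfolding jacobi_trudi_def by (rule sum.swap)
  finally show ?thesis .
qed

lemma jacobi_trudi_equal_rows:
  assumes "Suc i < n" "a (Suc i) = a i + 1"
  shows "jacobi_trudi n a m = 0"
proof -
  let ?\<tau> = "transpose i (Suc i)"
  let ?term = "\<lambda>p. sign p * elementary_coeff n (\<lambda>j. a (p j) - int (p j) + int j) m"
  have \<tau>: "?\<tau> permutes {..<n}"
    using assms(1) by (intro permutes_swap_id) auto
  have rows: "a (?\<tau> l) - int (?\<tau> l) = a l - int l" for l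
    using assms(2) by (simp add: transpose_def)
  have "?term (?\<tau> \<circ> p) = - ?term p" if "p permutes {..<n}" for p
  proof -
    have "permutation ?\<tau>" "permutation p"
      using that \<tau> by (auto simp: permutation_permutes)
    then have "sign (?\<tau> \<circ> p) = - sign p"
      by (simp add: sign_compose sign_swap_id)
    then show ?thesis by (simp add: rows)
  qed
  then have "(\<Sum>p | p permutes {..<n}. ?term (?\<tau> \<circ> p)) = (\<Sum>p | p permutes {..<n}. - ?term p)"
    by simp
  then have "jacobi_trudi n a m = - jacobi_trudi n a m"
    unfolding jacobi_trudi_def sum_negf by (subst setum_permutations_compose_left[OF \<tau>])
  then show ?thesis by simp
qed

lemma jacobi_trudi_last_neg:
  assumes "0 < n" "a (n - 1) < 0"
  shows "jacobi_trudi n a m = 0"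
  unfolding jacobi_trudi_def
proof (intro sum.neutral ballI)
  fix p assume "p \<in> {p. p permutes {..<n}}"
  then have p: "p permutes {..<n}" by simp
  then obtain j where "j < n" "p j = n - 1"
    using permutes_image[OF p] assms(1) by (metis diff_less imageE lessThan_iff zero_less_one)
  then show "sign p * elementary_coeff n (\<lambda>j. a (p j) - int (p j) + int j) m = 0"
    using assms(2) by (subst elementary_coeff_neg[of j]) auto
qed

lemma jacobi_trudi_empty:
  assumes "\<And>j. j < n \<Longrightarrow> 0 \<le> a j"
  shows "jacobi_trudi n a {#} = of_bool (\<forall>j<n. a j = 0)"
proof (cases "\<forall>j<n. a j = 0")
  case True
  have "(\<forall>j<n. a (p j) - int (p j) + int j = 0) \<longleftrightarrow> p = id" if p: "p permutes {..<n}" for p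
  proof
    assume rows: "\<forall>j<n. a (p j) - int (p j) + int j = 0"
    have "p j = j" for j
      using rows True p permutes_in_image[OF p, of j] permutes_not_in[OF p, of j]
      by (cases "j < n") auto
    then show "p = id" by auto
  qed (use True in simp)
  then have "jacobi_trudi n a {#} = (\<Sum>p | p permutes {..<n}. if p = id then 1 else 0)"
    unfolding jacobi_trudi_def elementary_coeff_empty by (intro sum.cong) auto
  then show ?thesis using True by (simp add: finite_permutations permutes_id)
next
  case False
  have "\<not> (\<forall>j<n. a (p j) - int (p j) + int j = 0)" if p: "p permutes {..<n}" for p
  proof
    assume "\<forall>j<n. a (p j) - int (p j) + int j = 0"
    then have "(\<Sum>j<n. a (p j) - int (p j) + int j) = 0" by simp
    then have "(\<Sum>j<n. a j) = 0"
      using sum.permute[OF p, of a] sum.permute[OF p, of int]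
      by (simp add: sum.distrib sum_subtractf comp_def)
    then have "\<forall>j<n. a j = 0"
      using assms by (subst (asm) sum_nonneg_eq_0_iff) auto
    with False show False by simp
  qed
  then show ?thesis
    using False unfolding jacobi_trudi_def elementary_coeff_empty by (auto intro!: sum.neutral)
qed

lemma jacobi_trudi_shorten_eq_0:
  assumes a: "column_lengths n a" and "\<not> column_lengths n (shorten a J)"
  shows "jacobi_trudi n (shorten a J) m = 0"
proof (cases "\<forall>i. Suc i < n \<longrightarrow> shorten a J (Suc i) \<le> shorten a J i")
  case True
  have anti: "shorten a J j \<le> shorten a J i" if "i \<le> j" "j < n" for i j
    using that
  proof (induction rule: dec_induct)
    case (step j)
    then show ?case using True by (metis Suc_lessD order.trans)
  qed simp
  then have "antimono_on {..<n} (shorten a J)"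
    by (auto simp: monotone_on_def)
  then obtain j where j: "j < n" "shorten a J j < 0"
    using assms(2) by (auto simp: column_lengths_def not_le)
  then have "shorten a J (n - 1) < 0"
    using anti[of j "n - 1"] by linarith
  then show ?thesis using j by (intro jacobi_trudi_last_neg) auto
next
  case False
  then obtain i where i: "Suc i < n" "shorten a J i < shorten a J (Suc i)"
    by (auto simp: not_le)
  moreover have "a (Suc i) \<le> a i"
    using a i(1) by (auto simp: column_lengths_def monotone_on_def)
  ultimately have "shorten a J (Suc i) = shorten a J i + 1"
    by (auto simp: shorten_def split: split_of_bool_asm)
  then show ?thesis by (rule jacobi_trudi_equal_rows[OF i(1)])
qed

lemma multiset_induct_remove_max [case_names empty add]:
  fixes m :: "'a :: linorder multiset"
  assumes "P {#}"
    and "\<And>m M x. (\<And>v. v \<in># m \<Longrightarrow> v < M) \<Longrightarrow> P m \<Longrightarrow> P (m + replicate_mset x M)"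
  shows "P m"
proof (induction "size m" arbitrary: m rule: less_induct)
  case less
  show ?case
  proof (cases "m = {#}")
    case False
    define M where "M = Max (set_mset m)"
    have M: "M \<in># m" "\<And>v. v \<in># m \<Longrightarrow> v \<le> M"
      using False by (auto simp: M_def)
    have split: "m = filter_mset (\<lambda>v. v \<noteq> M) m + replicate_mset (count m M) M"
      by (rule multiset_eqI) auto
    have "filter_mset (\<lambda>v. v \<noteq> M) m \<subset># m"
      using M(1) by (metis (mono_tags, lifting) filter_mset_eq_conv multiset_filter_subset
          subset_mset.less_le)
    then have "P (filter_mset (\<lambda>v. v \<noteq> M) m)"
      by (intro less mset_subset_size)
    then show ?thesis
      by (subst split) (intro assms(2), use M in \<open>auto simp: order_le_neq_trans\<close>)
  qed (simp add: assms(1))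
qed

lemma card_ssyt_empty:
  assumes "finite D"
  shows "card (ssyt D ({#} :: 'v :: linorder multiset)) = of_bool (D = {})"
proof (cases "D = {}")
  case True
  then have "ssyt D ({#} :: 'v multiset) = {\<lambda>_. undefined}"
    by (auto simp: ssyt_def semistandard_on_def)
  then show ?thesis using True by simp
next
  case False
  then have "ssyt D ({#} :: 'v multiset) = {}"
    using assms by (auto simp: ssyt_def mset_set_empty_iff)
  then show ?thesis using False by simp
qed

theorem dual_jacobi_trudi:
  assumes "column_lengths n a"
  shows "int (card (ssyt (column_diagram n a) m)) = jacobi_trudi n a m"
  using assms
proof (induction m arbitrary: a rule: multiset_induct_remove_max)
  case empty
  then have nonneg: "0 \<le> a j" if "j < n" for j
    using that by (simp add: column_lengths_def)
  have "column_diagram n a = {} \<longleftrightarrow> (\<forall>j<n. a j = 0)"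
  proof
    assume empty: "column_diagram n a = {}"
    show "\<forall>j<n. a j = 0"
    proof (intro allI impI)
      fix j assume "j < n"
      then have "(0, j) \<notin> column_diagram n a" by (simp add: empty)
      then show "a j = 0" using nonneg \<open>j < n\<close> by fastforce
    qed
  qed (auto simp: column_diagram_def)
  then show ?case
    by (simp add: card_ssyt_empty finite_column_diagram jacobi_trudi_empty nonneg)
next
  case (add m M x)
  have M: "M \<notin># m" using add.hyps by blast
  have "int (card (ssyt (column_diagram n a) (m + replicate_mset x M)))
      = (\<Sum>J | J \<subseteq> {..<n} \<and> card J = x \<and> column_lengths n (shorten a J).
           jacobi_trudi n (shorten a J) m)"
    using card_ssyt_column_diagram_remove_max[OF add.prems add.hyps] add.IH by simp
  also have "\<dots> = (\<Sum>J | J \<subseteq> {..<n} \<and> card J = x. jacobi_trudi n (shorten a J) m)"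
    using jacobi_trudi_shorten_eq_0[OF add.prems] by (intro sum.mono_neutral_left) auto
  also have "\<dots> = jacobi_trudi n a (m + replicate_mset x M)"
    by (rule jacobi_trudi_add_new[OF M, symmetric])
  finally show ?case .
qed

section \<open>Stable partitions\<close>

lemma count_content:
  assumes "finite D"
  shows "count (content f D) c = card {z \<in> D. f z = c}"
  using assms by (simp add: count_image_mset' eq_commute[of c])

abbreviation multiplicities :: "'v multiset \<Rightarrow> nat multiset" where
  "multiplicities m \<equiv> content (count m) (set_mset m)"

definition mult_fact :: "'b multiset \<Rightarrow> nat" where
  "mult_fact \<mu> = (\<Prod>i\<in>set_mset \<mu>. fact (count \<mu> i))"

lemma mult_fact_add_mset: "mult_fact (add_mset i \<mu>) = Suc (count \<mu> i) * mult_fact \<mu>"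
proof -
  have "mult_fact (add_mset i \<mu>)
      = fact (Suc (count \<mu> i)) * (\<Prod>j\<in>set_mset \<mu> - {i}. fact (count (add_mset i \<mu>) j))"
    by (simp add: mult_fact_def prod.insert_remove)
  also have "(\<Prod>j\<in>set_mset \<mu> - {i}. fact (count (add_mset i \<mu>) j))
      = (\<Prod>j\<in>set_mset \<mu> - {i}. fact (count \<mu> j))"
    by (intro prod.cong) auto
  also have "fact (Suc (count \<mu> i)) * \<dots> = Suc (count \<mu> i) * (fact (count \<mu> i) * \<dots>)"
    by (simp add: algebra_simps)
  also have "fact (count \<mu> i) * (\<Prod>j\<in>set_mset \<mu> - {i}. fact (count \<mu> j)) = mult_fact \<mu>"
    unfolding mult_fact_def by (cases "i \<in># \<mu>") (simp_all add: prod.remove[of _ i] not_in_iff)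
  finally show ?thesis .
qed

definition label_bijections :: "'a set \<Rightarrow> 'b set \<Rightarrow> ('a \<Rightarrow> 'l) \<Rightarrow> ('b \<Rightarrow> 'l) \<Rightarrow> ('a \<Rightarrow> 'b) set" where
  "label_bijections A B l l' = {g \<in> extensional A. bij_betw g A B \<and> (\<forall>a\<in>A. l' (g a) = l a)}"

lemma bij_betw_label_bijections_insert:
  assumes "a \<notin> A"
  shows "bij_betw (\<lambda>g. (g a, restrict g A)) (label_bijections (insert a A) B l l')
    (SIGMA b:{b \<in> B. l' b = l a}. label_bijections A (B - {b}) l l')"
proof (rule bij_betw_byWitness[where f' = "\<lambda>(b, g). g(a := b)"])
  show "\<forall>g\<in>label_bijections (insert a A) B l l'. (\<lambda>(b, g). g(a := b)) (g a, restrict g A) = g"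
    by (auto simp: label_bijections_def extensional_def fun_eq_iff)
  show "\<forall>p\<in>SIGMA b:{b \<in> B. l' b = l a}. label_bijections A (B - {b}) l l'.
      (\<lambda>g. (g a, restrict g A)) ((\<lambda>(b, g). g(a := b)) p) = p"
    using assms by (auto simp: label_bijections_def extensional_def fun_eq_iff)
  show "(\<lambda>g. (g a, restrict g A)) ` label_bijections (insert a A) B l l'
      \<subseteq> (SIGMA b:{b \<in> B. l' b = l a}. label_bijections A (B - {b}) l l')"
  proof clarify
    fix g assume g: "g \<in> label_bijections (insert a A) B l l'"
    then have bij: "bij_betw g (insert a A) B" by (simp add: label_bijections_def)
    then have "bij_betw g A (B - {g a})"
      using notIn_Un_bij_betw3[OF assms, of g "B - {g a}"] assms
      by (auto simp: bij_betw_def insert_absorb)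
    then have "bij_betw (restrict g A) A (B - {g a})"
      by (simp add: bij_betw_restrict_eq)
    then show "g a \<in> {b \<in> B. l' b = l a} \<and> restrict g A \<in> label_bijections A (B - {g a}) l l'"
      using g bij by (auto simp: label_bijections_def bij_betw_def)
  qed
  show "(\<lambda>(b, g). g(a := b)) ` (SIGMA b:{b \<in> B. l' b = l a}. label_bijections A (B - {b}) l l')
      \<subseteq> label_bijections (insert a A) B l l'"
  proof clarify
    fix b g assume b: "b \<in> B" "l' b = l a" and g: "g \<in> label_bijections A (B - {b}) l l'"
    then have "bij_betw (g(a := b)) A (B - {b})"
      using assms by (subst bij_betw_cong[of _ _ g]) (auto simp: label_bijections_def)
    then have "bij_betw (g(a := b)) (insert a A) B"
      using notIn_Un_bij_betw[OF assms, of "g(a := b)" "B - {b}"] b by (simp add: insert_absorb)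
    then show "g(a := b) \<in> label_bijections (insert a A) B l l'"
      using b g assms by (auto simp: label_bijections_def extensional_def)
  qed
qed

lemma finite_label_bijections:
  assumes "finite A" "finite B"
  shows "finite (label_bijections A B l l')"
proof (rule finite_subset)
  show "label_bijections A B l l' \<subseteq> A \<rightarrow>\<^sub>E B"
    by (auto simp: label_bijections_def bij_betw_def PiE_def)
  show "finite (A \<rightarrow>\<^sub>E B)"
    using assms by (intro finite_PiE) auto
qed

lemma card_label_bijections:
  assumes "finite A" "finite B"
  shows "card (label_bijections A B l l')
    = (if content l A = content l' B then mult_fact (content l A) else 0)"
  using assms
proof (induction A arbitrary: B rule: finite_induct)
  case empty
  then show ?case
    by (auto simp: label_bijections_def mult_fact_def mset_set_empty_iff bij_betw_def)
next
  case (insert a A)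
  let ?Bs = "{b \<in> B. l' b = l a}"
  have remove: "content l' B = add_mset (l a) (content l' (B - {b}))" if "b \<in> ?Bs" for b
    using content_Diff[OF insert.prems, of "{b}" l'] that by simp
  have "card (label_bijections (insert a A) B l l')
      = card (SIGMA b:?Bs. label_bijections A (B - {b}) l l')"
    by (rule bij_betw_same_card[OF bij_betw_label_bijections_insert[OF insert.hyps(2)]])
  also have "\<dots> = (\<Sum>b\<in>?Bs. card (label_bijections A (B - {b}) l l'))"
    using insert by (intro card_SigmaI) (auto simp: finite_label_bijections)
  also have "\<dots> = (\<Sum>b\<in>?Bs. if content l (insert a A) = content l' B
      then mult_fact (content l A) else 0)"
    using insert by (intro sum.cong) (simp_all add: remove)
  also have "\<dots> = (if content l (insert a A) = content l' B
      then count (content l' B) (l a) * mult_fact (content l A) else 0)"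
    using insert.prems by (simp add: count_content)
  also have "\<dots> = (if content l (insert a A) = content l' B
      then mult_fact (content l (insert a A)) else 0)"
    using insert.hyps by (auto simp: mult_fact_add_mset dest!: sym[of "add_mset _ _"])
  finally show ?case .
qed

definition color_classes :: "'a set \<Rightarrow> ('a \<Rightarrow> 'c) \<Rightarrow> 'a set set" where
  "color_classes V \<kappa> = (\<lambda>c. {a \<in> V. \<kappa> a = c}) ` \<kappa> ` V"

definition block :: "'a set set \<Rightarrow> 'a \<Rightarrow> 'a set" where
  "block \<pi> a = (THE B. B \<in> \<pi> \<and> a \<in> B)"

lemma block_eq: "partition_on V \<pi> \<Longrightarrow> B \<in> \<pi> \<Longrightarrow> a \<in> B \<Longrightarrow> block \<pi> a = B"
  unfolding block_def by (intro the_equality) (auto dest: partition_onD2 disjointD)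

lemma partition_on_color_classes: "partition_on V (color_classes V \<kappa>)"
  by (rule partition_onI) (auto simp: color_classes_def disjnt_def)

definition class_color :: "('a \<Rightarrow> 'c) \<Rightarrow> 'a set \<Rightarrow> 'c" where
  "class_color \<kappa> B = the_elem (\<kappa> ` B)"

lemma class_color_eq:
  "B \<noteq> {} \<Longrightarrow> (\<And>a. a \<in> B \<Longrightarrow> \<kappa> a = c) \<Longrightarrow> class_color \<kappa> B = c"
  unfolding class_color_def by (rule the_elem_image_unique)

lemma class_color_fiber: "c \<in> \<kappa> ` V \<Longrightarrow> class_color \<kappa> {a \<in> V. \<kappa> a = c} = c"
  by (rule class_color_eq) auto

lemma color_classes_label_bijection:
  assumes V: "finite V" and \<kappa>: "content \<kappa> V = m"
  shows "restrict (class_color \<kappa>) (color_classes V \<kappa>)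
    \<in> label_bijections (color_classes V \<kappa>) (set_mset m) card (count m)"
proof -
  have m: "set_mset m = \<kappa> ` V" using \<kappa> V by auto
  have "class_color \<kappa> ` color_classes V \<kappa> = \<kappa> ` V"
    by (simp add: color_classes_def image_image class_color_fiber)
  moreover have "inj_on (class_color \<kappa>) (color_classes V \<kappa>)"
    unfolding color_classes_def by (rule inj_onI) (auto simp: class_color_fiber)
  moreover have "count m (class_color \<kappa> B) = card B" if "B \<in> color_classes V \<kappa>" for B
    using that by (auto simp: color_classes_def class_color_fiber count_content[OF V] simp flip: \<kappa>)
  ultimately show ?thesis
    by (auto simp: label_bijections_def bij_betw_def m inj_on_restrict_eq)
qed

lemma block_coloring_eq:
  assumes \<pi>: "partition_on V \<pi>" and B: "B \<in> \<pi>" "a \<in> B"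
  shows "restrict (\<lambda>a. g (block \<pi> a)) V a = g B"
  using assms partition_onD1[OF \<pi>] by (auto simp: block_eq[OF \<pi> B])

lemma block_coloring_fiber:
  assumes \<pi>: "partition_on V \<pi>" and g: "inj_on g \<pi>" and B: "B \<in> \<pi>"
  shows "{a \<in> V. restrict (\<lambda>a. g (block \<pi> a)) V a = g B} = B"
proof (intro subset_antisym subsetI)
  fix a assume a: "a \<in> {a \<in> V. restrict (\<lambda>a. g (block \<pi> a)) V a = g B}"
  then obtain C where C: "C \<in> \<pi>" "a \<in> C" using partition_onD1[OF \<pi>] by auto
  then have "g C = g B" using a block_coloring_eq[OF \<pi> C, of g] by auto
  then show "a \<in> B" using inj_onD[OF g _ C(1) B] C(2) by simp
next
  fix a assume "a \<in> B"
  then show "a \<in> {a \<in> V. restrict (\<lambda>a. g (block \<pi> a)) V a = g B}"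
    using block_coloring_eq[OF \<pi> B] B partition_onD1[OF \<pi>] by blast
qed

lemma block_coloring_image:
  assumes \<pi>: "partition_on V \<pi>"
  shows "restrict (\<lambda>a. g (block \<pi> a)) V ` V = g ` \<pi>"
proof (intro subset_antisym subsetI)
  fix c assume "c \<in> restrict (\<lambda>a. g (block \<pi> a)) V ` V"
  then obtain a where a: "a \<in> V" "c = restrict (\<lambda>a. g (block \<pi> a)) V a" by blast
  then obtain B where "B \<in> \<pi>" "a \<in> B" using partition_onD1[OF \<pi>] by auto
  then show "c \<in> g ` \<pi>" using a(2) block_coloring_eq[OF \<pi>, of B a g] by blast
next
  fix c assume "c \<in> g ` \<pi>"
  then obtain B where B: "B \<in> \<pi>" "c = g B" by blast
  then obtain a where a: "a \<in> B" using partition_onD3[OF \<pi>] by (metis all_not_in_conv)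
  show "c \<in> restrict (\<lambda>a. g (block \<pi> a)) V ` V"
  proof (rule image_eqI)
    show "c = restrict (\<lambda>a. g (block \<pi> a)) V a"
      using B(2) block_coloring_eq[OF \<pi> B(1) a, of g] by simp
    show "a \<in> V" using B(1) a partition_onD1[OF \<pi>] by blast
  qed
qed

lemma label_bijection_coloring:
  assumes V: "finite V" and \<pi>: "partition_on V \<pi>"
    and g: "g \<in> label_bijections \<pi> (set_mset m) card (count m)"
  defines "\<kappa> \<equiv> restrict (\<lambda>a. g (block \<pi> a)) V"
  shows "content \<kappa> V = m" "color_classes V \<kappa> = \<pi>" "restrict (class_color \<kappa>) \<pi> = g"
proof -
  have bij: "bij_betw g \<pi> (set_mset m)" and card: "\<And>B. B \<in> \<pi> \<Longrightarrow> count m (g B) = card B"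
    using g by (auto simp: label_bijections_def)
  have fiber: "{a \<in> V. \<kappa> a = g B} = B" if "B \<in> \<pi>" for B
    unfolding \<kappa>_def using that bij by (intro block_coloring_fiber \<pi>) (auto simp: bij_betw_def)
  have range: "\<kappa> ` V = set_mset m"
    unfolding \<kappa>_def block_coloring_image[OF \<pi>] using bij by (simp add: bij_betw_def)
  show "content \<kappa> V = m"
  proof (rule multiset_eqI)
    fix c show "count (content \<kappa> V) c = count m c"
    proof (cases "c \<in># m")
      case True
      then obtain B where "B \<in> \<pi>" "c = g B" using bij by (auto simp: bij_betw_def)
      then show ?thesis using card fiber by (simp add: count_content[OF V])
    next
      case False
      then have "c \<notin># content \<kappa> V" using range V by auto
      then show ?thesis using False by (simp only: not_in_iff)
    qed
  qed
  have "color_classes V \<kappa> = (\<lambda>B. {a \<in> V. \<kappa> a = g B}) ` \<pi>"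
    unfolding color_classes_def range using bij by (auto simp: bij_betw_def)
  then show "color_classes V \<kappa> = \<pi>" using fiber by simp
  have "class_color \<kappa> B = g B" if "B \<in> \<pi>" for B
    unfolding \<kappa>_def using that partition_onD3[OF \<pi>]
    by (intro class_color_eq block_coloring_eq[OF \<pi>]) auto
  then show "restrict (class_color \<kappa>) \<pi> = g"
    using g by (auto simp: label_bijections_def extensional_def fun_eq_iff)
qed

lemma bij_betw_color_classes:
  assumes V: "finite V"
  shows "bij_betw (\<lambda>\<kappa>. (color_classes V \<kappa>, restrict (class_color \<kappa>) (color_classes V \<kappa>)))
    {\<kappa> \<in> extensional V. content \<kappa> V = m \<and> P (color_classes V \<kappa>)}
    (SIGMA \<pi>:{\<pi>. partition_on V \<pi> \<and> P \<pi>}. label_bijections \<pi> (set_mset m) card (count m))"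
  (is "bij_betw ?split ?colorings ?pairs")
proof (rule bij_betw_byWitness[where f' = "\<lambda>(\<pi>, g). \<lambda>a\<in>V. g (block \<pi> a)"])
  let ?join = "\<lambda>(\<pi>, g). \<lambda>a\<in>V. g (block \<pi> a)"
  have block: "block (color_classes V \<kappa>) a \<in> color_classes V \<kappa>"
    "class_color \<kappa> (block (color_classes V \<kappa>) a) = \<kappa> a" if "a \<in> V" for \<kappa> :: "'a \<Rightarrow> 'b" and a
  proof -
    have "{a' \<in> V. \<kappa> a' = \<kappa> a} \<in> color_classes V \<kappa>"
      using that by (auto simp: color_classes_def)
    moreover from this have "block (color_classes V \<kappa>) a = {a' \<in> V. \<kappa> a' = \<kappa> a}"
      using that by (intro block_eq[OF partition_on_color_classes]) auto
    ultimately show "block (color_classes V \<kappa>) a \<in> color_classes V \<kappa>"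
      "class_color \<kappa> (block (color_classes V \<kappa>) a) = \<kappa> a"
      using that by (simp_all add: class_color_fiber)
  qed
  show "\<forall>\<kappa>\<in>?colorings. ?join (?split \<kappa>) = \<kappa>"
    using block by (auto simp: extensional_def fun_eq_iff)
  show "\<forall>p\<in>?pairs. ?split (?join p) = p"
    using label_bijection_coloring(2,3)[OF V] by auto
  show "?split ` ?colorings \<subseteq> ?pairs"
    using color_classes_label_bijection[OF V] partition_on_color_classes by auto
  show "?join ` ?pairs \<subseteq> ?colorings"
    using label_bijection_coloring(1,2)[OF V, where m = m] by (auto simp: Pi_def)
qed

definition stable :: "'a ugraph \<Rightarrow> 'a set \<Rightarrow> bool" where
  "stable G B \<longleftrightarrow> B \<subseteq> verts G \<and> (\<forall>a\<in>B. \<forall>b\<in>B. {a, b} \<notin> edges G)"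

definition stable_partitions :: "'a ugraph \<Rightarrow> 'a set set set" where
  "stable_partitions G = {\<pi>. partition_on (verts G) \<pi> \<and> (\<forall>B\<in>\<pi>. stable G B)}"

lemma finite_stable_partitions: "finite (verts G) \<Longrightarrow> finite (stable_partitions G)"
  by (rule finite_subset[OF _ finitely_many_partition_on]) (auto simp: stable_partitions_def)

lemma proper_coloring_iff_stable:
  assumes G: "finite_simple_graph G"
  shows "proper_coloring G \<kappa> \<longleftrightarrow>
    \<kappa> \<in> verts G \<rightarrow>\<^sub>E {1..} \<and> (\<forall>B\<in>color_classes (verts G) \<kappa>. stable G B)"
proof -
  have ends: "a \<in> verts G" "b \<in> verts G" if "{a, b} \<in> edges G" for a b
    using G that unfolding finite_simple_graph_def by (metis doubleton_eq_iff)+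
  have "(\<forall>B\<in>color_classes (verts G) \<kappa>. stable G B)
      \<longleftrightarrow> (\<forall>a\<in>verts G. \<forall>b\<in>verts G. \<kappa> a = \<kappa> b \<longrightarrow> {a, b} \<notin> edges G)"
    by (auto simp: color_classes_def stable_def)
  also have "\<dots> \<longleftrightarrow> (\<forall>a b. {a, b} \<in> edges G \<longrightarrow> \<kappa> a \<noteq> \<kappa> b)"
    using ends by blast
  finally show ?thesis by (simp add: proper_coloring_def)
qed

lemma chromatic_sym_eq_stable_partitions:
  assumes G: "finite_simple_graph G" and m: "0 \<notin># m"
  shows "chromatic_sym G m = of_nat (mult_fact (multiplicities m)
    * card {\<pi> \<in> stable_partitions G. content card \<pi> = multiplicities m})"
proof -
  let ?V = "verts G"
  let ?stable = "\<lambda>\<pi>. \<forall>B\<in>\<pi>. stable G B"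
  have V: "finite ?V" using G by (simp add: finite_simple_graph_def)
  have "\<kappa> \<in> ?V \<rightarrow>\<^sub>E {1..}" if "\<kappa> \<in> extensional ?V" "content \<kappa> ?V = m" for \<kappa>
  proof -
    have "\<kappa> ` ?V = set_mset m" using that(2) V by auto
    then have "\<kappa> z \<noteq> 0" if "z \<in> ?V" for z
      using that m by (metis imageI)
    then show ?thesis using that(1) by (auto simp: PiE_def Suc_le_eq)
  qed
  then have "{\<kappa>. proper_coloring G \<kappa> \<and> content \<kappa> ?V = m}
      = {\<kappa> \<in> extensional ?V. content \<kappa> ?V = m \<and> ?stable (color_classes ?V \<kappa>)}"
    using proper_coloring_iff_stable[OF G] by (auto simp: PiE_def)
  then have "card {\<kappa>. proper_coloring G \<kappa> \<and> content \<kappa> ?V = m}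
      = card (SIGMA \<pi>:stable_partitions G. label_bijections \<pi> (set_mset m) card (count m))"
    using bij_betw_same_card[OF bij_betw_color_classes[OF V, of m ?stable]]
    by (simp add: stable_partitions_def)
  also have "\<dots> = (\<Sum>\<pi>\<in>stable_partitions G. card (label_bijections \<pi> (set_mset m) card (count m)))"
    using V by (intro card_SigmaI finite_stable_partitions)
      (auto simp: stable_partitions_def intro!: finite_label_bijections finite_elements)
  also have "\<dots> = (\<Sum>\<pi>\<in>stable_partitions G.
      if content card \<pi> = multiplicities m then mult_fact (multiplicities m) else 0)"
    using V by (intro sum.cong)
      (auto simp: stable_partitions_def card_label_bijections finite_elements)
  also have "\<dots> = mult_fact (multiplicities m)
      * card {\<pi> \<in> stable_partitions G. content card \<pi> = multiplicities m}"
    using V by (simp add: finite_stable_partitions flip: sum.inter_filter)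
  finally show ?thesis by (simp add: chromatic_sym_def)
qed

definition stable_packings :: "'a ugraph \<Rightarrow> 'a set set set" where
  "stable_packings G = {N. disjoint N \<and> (\<forall>B\<in>N. stable G B \<and> 2 \<le> card B)}"

lemma singleton_notin_edges: "finite_simple_graph G \<Longrightarrow> {a} \<notin> edges G"
  by (fastforce simp: finite_simple_graph_def)

lemma partition_on_union_singletons:
  assumes "disjoint N" "\<Union>N \<subseteq> V" "{} \<notin> N"
  shows "partition_on V (N \<union> (\<lambda>a. {a}) ` (V - \<Union>N))"
proof (rule partition_onI)
  show "\<Union>(N \<union> (\<lambda>a. {a}) ` (V - \<Union>N)) = V"
    using assms(2) by auto
  show "disjnt B C" if "B \<in> N \<union> (\<lambda>a. {a}) ` (V - \<Union>N)" "C \<in> N \<union> (\<lambda>a. {a}) ` (V - \<Union>N)" "B \<noteq> C" for B C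
    using that disjointD[OF assms(1)] by (auto simp: disjnt_def)
qed (use assms(3) in auto)

lemma eq_singleton_if_card_less_2:
  assumes "finite B" "\<not> 2 \<le> card B" "a \<in> B"
  shows "B = {a}"
proof -
  have "0 < card B" using assms(1,3) by (auto simp: card_gt_0_iff)
  then have "card B = 1" using assms(2) by linarith
  then show ?thesis using assms(3) by (metis card_1_singletonE singletonD)
qed

lemma partition_eq_union_singletons:
  assumes V: "finite V" and \<pi>: "partition_on V \<pi>"
  defines "N \<equiv> {B \<in> \<pi>. 2 \<le> card B}"
  shows "\<pi> = N \<union> (\<lambda>a. {a}) ` (V - \<Union>N)"
proof -
  have V_eq: "\<Union>\<pi> = V" and nonempty: "{} \<notin> \<pi>" and disj: "disjoint \<pi>"
    using \<pi> by (simp_all add: partition_on_def)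
  have single: "B = {a}" if "B \<in> \<pi>" "B \<notin> N" "a \<in> B" for a B
  proof (rule eq_singleton_if_card_less_2)
    show "finite B" using that(1) V V_eq by (auto intro: finite_subset)
  qed (use that in \<open>auto simp: N_def\<close>)
  show ?thesis
  proof (intro subset_antisym subsetI)
    fix B assume B: "B \<in> \<pi>"
    show "B \<in> N \<union> (\<lambda>a. {a}) ` (V - \<Union>N)"
    proof (cases "B \<in> N")
      case False
      obtain a where a: "a \<in> B" using B nonempty by (metis all_not_in_conv)
      have "a \<notin> \<Union>N" using B False a disjointD[OF disj] by (auto simp: N_def)
      then show ?thesis using single[OF B False a] a B V_eq by auto
    qed simp
  next
    fix B assume "B \<in> N \<union> (\<lambda>a. {a}) ` (V - \<Union>N)"
    then show "B \<in> \<pi>"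
    proof
      assume "B \<in> (\<lambda>a. {a}) ` (V - \<Union>N)"
      then obtain a C where "B = {a}" "C \<in> \<pi>" "a \<in> C" "C \<notin> N" using V_eq by blast
      then show ?thesis using single by blast
    qed (simp add: N_def)
  qed
qed

lemma bij_betw_stable_packings:
  assumes G: "finite_simple_graph G"
  shows "bij_betw (\<lambda>\<pi>. {B \<in> \<pi>. 2 \<le> card B}) (stable_partitions G) (stable_packings G)"
proof (rule bij_betw_byWitness[where f' = "\<lambda>N. N \<union> (\<lambda>a. {a}) ` (verts G - \<Union>N)"])
  have V: "finite (verts G)" using G by (simp add: finite_simple_graph_def)
  show "\<forall>\<pi>\<in>stable_partitions G.
      {B \<in> \<pi>. 2 \<le> card B} \<union> (\<lambda>a. {a}) ` (verts G - \<Union>{B \<in> \<pi>. 2 \<le> card B}) = \<pi>"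
    using partition_eq_union_singletons[OF V]
    by (auto simp only: stable_partitions_def mem_Collect_eq)
  show "\<forall>N\<in>stable_packings G.
      {B \<in> N \<union> (\<lambda>a. {a}) ` (verts G - \<Union>N). 2 \<le> card B} = N"
    by (auto simp: stable_packings_def)
  show "(\<lambda>\<pi>. {B \<in> \<pi>. 2 \<le> card B}) ` stable_partitions G \<subseteq> stable_packings G"
    by (auto simp: stable_partitions_def stable_packings_def partition_on_def
        intro: pairwise_subset)
  have "partition_on (verts G) (N \<union> (\<lambda>a. {a}) ` (verts G - \<Union>N))" if "N \<in> stable_packings G" for N
    using that by (intro partition_on_union_singletons) (auto simp: stable_packings_def stable_def)
  then show "(\<lambda>N. N \<union> (\<lambda>a. {a}) ` (verts G - \<Union>N)) ` stable_packings G \<subseteq> stable_partitions G"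
    using singleton_notin_edges[OF G]
    by (auto simp: stable_partitions_def stable_packings_def stable_def)
qed

lemma multiset_nat_split_ones:
  fixes \<mu> :: "nat multiset"
  assumes "0 \<notin># \<mu>"
  shows "\<mu> = replicate_mset (count \<mu> 1) 1 + filter_mset ((\<le>) 2) \<mu>"
proof (rule multiset_eqI)
  fix i :: nat
  consider "i = 0" | "i = 1" | "2 \<le> i" by linarith
  then show "count \<mu> i = count (replicate_mset (count \<mu> 1) 1 + filter_mset ((\<le>) 2) \<mu>) i"
    using assms by cases (auto simp: not_in_iff)
qed

lemma multiset_nat_eq_iff_filter_ge_2:
  fixes \<mu> \<nu> :: "nat multiset"
  assumes "0 \<notin># \<mu>" "0 \<notin># \<nu>" "\<Sum>\<^sub># \<mu> = \<Sum>\<^sub># \<nu>"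
  shows "\<mu> = \<nu> \<longleftrightarrow> filter_mset ((\<le>) 2) \<mu> = filter_mset ((\<le>) 2) \<nu>"
proof
  have sum: "\<Sum>\<^sub># \<rho> = count \<rho> 1 + \<Sum>\<^sub># (filter_mset ((\<le>) 2) \<rho>)" if "0 \<notin># \<rho>" for \<rho> :: "nat multiset"
    using arg_cong[OF multiset_nat_split_ones[OF that], of sum_mset]
    by (simp add: sum_mset_replicate_mset)
  assume filter: "filter_mset ((\<le>) 2) \<mu> = filter_mset ((\<le>) 2) \<nu>"
  with assms(3) have "count \<mu> 1 = count \<nu> 1"
    unfolding sum[OF assms(1)] sum[OF assms(2)] by simp
  then show "\<mu> = \<nu>"
    using multiset_nat_split_ones[OF assms(1)] multiset_nat_split_ones[OF assms(2)] filter by metis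
qed simp

lemma sum_mset_multiplicities: "\<Sum>\<^sub># (multiplicities m) = size m"
  unfolding sum_unfold_sum_mset[symmetric] by (rule size_multiset_overloaded_eq[symmetric])

lemma sum_mset_block_sizes:
  assumes "finite V" "partition_on V \<pi>"
  shows "\<Sum>\<^sub># (content card \<pi>) = card V"
proof -
  have "finite B" if "B \<in> \<pi>" for B
    using assms that by (auto simp: partition_on_def intro: finite_subset)
  then show ?thesis
    using product_partition[OF assms(2)] by (simp flip: sum_unfold_sum_mset)
qed

theorem chromatic_sym_eq_stable_packings:
  assumes G: "finite_simple_graph G" and m: "0 \<notin># m" and size: "size m = card (verts G)"
  shows "chromatic_sym G m = of_nat (mult_fact (multiplicities m)
    * card {N \<in> stable_packings G. content card N = filter_mset ((\<le>) 2) (multiplicities m)})"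
proof -
  let ?\<mu> = "multiplicities m"
  let ?big = "\<lambda>\<pi>. {B \<in> \<pi>. 2 \<le> card B}"
  have V: "finite (verts G)" using G by (simp add: finite_simple_graph_def)
  have iff: "content card \<pi> = ?\<mu> \<longleftrightarrow> content card (?big \<pi>) = filter_mset ((\<le>) 2) ?\<mu>"
    if \<pi>: "partition_on (verts G) \<pi>" for \<pi>
  proof -
    have fin: "finite \<pi>" by (rule finite_elements[OF V \<pi>])
    have "card B \<noteq> 0" if "B \<in> \<pi>" for B
    proof -
      have "B \<noteq> {}" "B \<subseteq> verts G" using \<pi> that by (auto simp: partition_on_def)
      then show ?thesis using finite_subset[OF _ V] by simp
    qed
    then have "0 \<notin># content card \<pi>" using fin by force
    moreover have "0 \<notin># ?\<mu>" by (auto simp: count_eq_zero_iff)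
    moreover have "\<Sum>\<^sub># (content card \<pi>) = \<Sum>\<^sub># ?\<mu>"
      by (simp add: sum_mset_multiplicities sum_mset_block_sizes[OF V \<pi>] size)
    moreover have "content card (?big \<pi>) = filter_mset ((\<le>) 2) (content card \<pi>)"
      using fin by (simp add: filter_mset_image_mset filter_mset_mset_set)
    ultimately show ?thesis
      using multiset_nat_eq_iff_filter_ge_2 by metis
  qed
  have "bij_betw ?big {\<pi> \<in> stable_partitions G. content card \<pi> = ?\<mu>}
      {N \<in> stable_packings G. content card N = filter_mset ((\<le>) 2) ?\<mu>}"
    using iff by (intro bij_betw_Collect[OF bij_betw_stable_packings[OF G]])
      (simp add: stable_partitions_def)
  then show ?thesis
    by (simp only: chromatic_sym_eq_stable_partitions[OF G m] bij_betw_same_card)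
qed

section \<open>Stable packings of the blown-up fork\<close>

abbreviation (input) blown_up_fork :: "nat \<Rightarrow> (fork_vertex + nat) ugraph" where
  "blown_up_fork k \<equiv> replace_by_clique fork_graph fork_w k"

lemma verts_blown_up_fork:
  "verts (blown_up_fork k) = {Inl fork_u, Inl fork_v, Inl fork_x, Inl fork_y} \<union> Inr ` {..k}"
  by (auto simp: verts_def replace_by_clique_def fork_graph_def)

lemma card_verts_blown_up_fork: "card (verts (blown_up_fork k)) = k + 5"
  unfolding verts_blown_up_fork by (subst card_Un_disjoint) (auto simp: card_image)

lemmas finite_simple_graph_blown_up_fork =
  finite_simple_graph_replace_by_clique[OF finite_simple_graph_fork]

lemma edges_blown_up_fork:
  "{Inl a, Inl b} \<in> edges (blown_up_fork k) \<longleftrightarrow> {a, b} = {fork_u, fork_v}"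
  "{Inl a, Inr i} \<in> edges (blown_up_fork k) \<longleftrightarrow> a \<in> {fork_v, fork_x, fork_y} \<and> i \<le> k"
  "{Inr i, Inl a} \<in> edges (blown_up_fork k) \<longleftrightarrow> a \<in> {fork_v, fork_x, fork_y} \<and> i \<le> k"
  "{Inr i, Inr j} \<in> edges (blown_up_fork k) \<longleftrightarrow> i \<le> k \<and> j \<le> k \<and> i \<noteq> j"
  by (auto simp: edges_def replace_by_clique_def fork_graph_def doubleton_eq_iff)

definition outer_blocks :: "(fork_vertex + nat) set set" where
  "outer_blocks = image Inl ` {{fork_u, fork_x}, {fork_u, fork_y}, {fork_u, fork_x, fork_y},
     {fork_x, fork_y}, {fork_v, fork_x}, {fork_v, fork_y}, {fork_v, fork_x, fork_y}}"

lemma stable_blown_up_fork_iff: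
  "stable (blown_up_fork k) B \<and> 2 \<le> card B
    \<longleftrightarrow> B \<in> outer_blocks \<or> (\<exists>i\<le>k. B = {Inl fork_u, Inr i})"
proof
  assume B: "stable (blown_up_fork k) B \<and> 2 \<le> card B"
  then have sub: "B \<subseteq> {Inl fork_u, Inl fork_v, Inl fork_x, Inl fork_y} \<union> Inr ` {..k}"
    and stable: "\<And>a b. a \<in> B \<Longrightarrow> b \<in> B \<Longrightarrow> {a, b} \<notin> edges (blown_up_fork k)"
    by (auto simp: stable_def verts_blown_up_fork)
  show "B \<in> outer_blocks \<or> (\<exists>i\<le>k. B = {Inl fork_u, Inr i})"
  proof (cases "\<exists>i. Inr i \<in> B")
    case True
    then obtain i where i: "Inr i \<in> B" "i \<le> k" using sub by auto
    have "b \<in> {Inl fork_u, Inr i}" if "b \<in> B" for b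
      using sub that stable[OF i(1) that] i(2) by (auto simp: edges_blown_up_fork)
    then have "B \<subseteq> {Inl fork_u, Inr i}" by blast
    moreover have "B \<noteq> {Inr i}" using B by auto
    ultimately have "B = {Inl fork_u, Inr i}" using i(1) by blast
    then show ?thesis using i(2) by blast
  next
    case False
    then have "B \<in> Pow {Inl fork_u, Inl fork_v, Inl fork_x, Inl fork_y}" using sub by auto
    moreover have "Inl fork_u \<notin> B \<or> Inl fork_v \<notin> B"
      using stable[of "Inl fork_u" "Inl fork_v"] by (auto simp: edges_blown_up_fork)
    moreover have "2 \<le> card B" using B by simp
    ultimately have "B \<in> outer_blocks"
      unfolding Pow_insert Pow_empty outer_blocks_def by (elim UnE imageE emptyE insertE; simp)
    then show ?thesis by blast
  qed
next
  assume "B \<in> outer_blocks \<or> (\<exists>i\<le>k. B = {Inl fork_u, Inr i})"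
  then show "stable (blown_up_fork k) B \<and> 2 \<le> card B"
    by (auto simp: outer_blocks_def stable_def verts_blown_up_fork edges_blown_up_fork
        doubleton_eq_iff
        singleton_notin_edges[OF finite_simple_graph_blown_up_fork])
qed

text \<open>
  A stable packing of the blown-up fork is determined by its block containing \<open>u\<close> and its trace on
  \<open>{v, x, y}\<close>: the block of \<open>u\<close> is missing in \<open>vxy_packings\<close>, lies in \<open>{u, x, y}\<close> in
  \<open>uvxy_packings\<close>, and is \<open>{u, w\<^sub>i}\<close> in \<open>clique_packings\<close>.
\<close>

definition vxy_packings :: "(fork_vertex + nat) set set set" where
  "vxy_packings = image (image Inl) `
    {{}, {{fork_x, fork_y}}, {{fork_v, fork_x}}, {{fork_v, fork_y}},
     {{fork_v, fork_x, fork_y}}}"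

definition uvxy_packings :: "(fork_vertex + nat) set set set" where
  "uvxy_packings = image (image Inl) ` {{{fork_u, fork_x}}, {{fork_u, fork_y}},
     {{fork_u, fork_x, fork_y}}, {{fork_u, fork_x}, {fork_v, fork_y}},
     {{fork_u, fork_y}, {fork_v, fork_x}}}"

definition clique_packings :: "nat \<Rightarrow> (fork_vertex + nat) set set set" where
  "clique_packings k = (\<Union>i\<le>k. insert {Inl fork_u, Inr i} ` vxy_packings)"

lemma outer_blocks_avoiding_u:
  assumes N: "disjoint N" "N \<subseteq> outer_blocks" and u: "\<And>B. B \<in> N \<Longrightarrow> Inl fork_u \<notin> B"
  shows "N \<in> vxy_packings"
proof -
  have block: "B \<in> image Inl ` {{fork_x, fork_y}, {fork_v, fork_x}, {fork_v, fork_y},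
      {fork_v, fork_x, fork_y}}"
    if "B \<in> N" for B
  proof -
    have "B \<in> outer_blocks" using N(2) that by blast
    then show ?thesis using u[OF that] by (auto simp: outer_blocks_def)
  qed
  have meet: "B \<inter> C \<noteq> {}" if "B \<in> N" "C \<in> N" for B C
    using block[OF that(1)] block[OF that(2)] by auto
  then have same: "B = C" if "B \<in> N" "C \<in> N" for B C
    using that disjointD[OF N(1)] by blast
  show ?thesis
  proof (cases "N = {}")
    case False
    then obtain B where "B \<in> N" by blast
    then have "N = {B}" using same by blast
    then show ?thesis using block[OF \<open>B \<in> N\<close>] by (auto simp: vxy_packings_def)
  qed (simp add: vxy_packings_def)
qed

lemma insert_outer_block_mem_uvxy_packings:
  assumes M: "M \<in> vxy_packings" and B: "B \<in> outer_blocks" "Inl fork_u \<in> B"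
    and disj: "\<And>C. C \<in> M \<Longrightarrow> C \<inter> B = {}"
  shows "insert B M \<in> uvxy_packings"
proof -
  consider (ux) "B = Inl ` {fork_u, fork_x}" | (uy) "B = Inl ` {fork_u, fork_y}"
    | (uxy) "B = Inl ` {fork_u, fork_x, fork_y}"
    using B by (auto simp: outer_blocks_def)
  then show ?thesis
  proof cases
    case ux
    then have "M \<in> {{}, {Inl ` {fork_v, fork_y}}}"
      using M disj by (auto simp: vxy_packings_def)
    then show ?thesis using ux by (auto simp: uvxy_packings_def)
  next
    case uy
    then have "M \<in> {{}, {Inl ` {fork_v, fork_x}}}"
      using M disj by (auto simp: vxy_packings_def)
    then show ?thesis using uy by (auto simp: uvxy_packings_def)
  next
    case uxy
    then have "M = {}"
      using M disj by (auto simp: vxy_packings_def)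
    then show ?thesis using uxy by (auto simp: uvxy_packings_def)
  qed
qed

lemma stable_packings_blown_up_fork_iff:
  "N \<in> stable_packings (blown_up_fork k)
    \<longleftrightarrow> disjoint N \<and> (\<forall>B\<in>N. B \<in> outer_blocks \<or> (\<exists>i\<le>k. B = {Inl fork_u, Inr i}))"
  unfolding stable_packings_def mem_Collect_eq stable_blown_up_fork_iff ..

lemma stable_packings_blown_up_fork_subset:
  "stable_packings (blown_up_fork k) \<subseteq> vxy_packings \<union> uvxy_packings \<union> clique_packings k"
proof
  fix N assume "N \<in> stable_packings (blown_up_fork k)"
  then have disj: "disjoint N"
    and blocks: "\<And>B. B \<in> N \<Longrightarrow> B \<in> outer_blocks \<or> (\<exists>i\<le>k. B = {Inl fork_u, Inr i})"
    by (auto simp: stable_packings_blown_up_fork_iff)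
  show "N \<in> vxy_packings \<union> uvxy_packings \<union> clique_packings k"
  proof (cases "\<exists>B\<in>N. Inl fork_u \<in> B")
    case False
    then have "N \<in> vxy_packings"
      using blocks by (intro outer_blocks_avoiding_u disj) blast+
    then show ?thesis by blast
  next
    case True
    then obtain B where B: "B \<in> N" "Inl fork_u \<in> B" by blast
    define M where "M = N - {B}"
    have N: "N = insert B M" using B(1) by (auto simp: M_def)
    have M_disj: "C \<inter> B = {}" if "C \<in> M" for C
      using disjointD[OF disj, of C B] that B(1) by (auto simp: M_def)
    have "disjoint M"
      by (rule pairwise_subset[OF disj]) (simp add: M_def)
    moreover have no_u: "Inl fork_u \<notin> C" if "C \<in> M" for C
      using M_disj[OF that] B(2) by blast
    moreover have "M \<subseteq> outer_blocks"
      using blocks no_u by (auto simp: M_def)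
    ultimately have M: "M \<in> vxy_packings" by (intro outer_blocks_avoiding_u)
    consider (outer) "B \<in> outer_blocks" | (clique) i where "i \<le> k" "B = {Inl fork_u, Inr i}"
      using blocks[OF B(1)] by blast
    then show ?thesis
    proof cases
      case outer
      then show ?thesis
        using insert_outer_block_mem_uvxy_packings[OF M outer B(2) M_disj] by (simp add: N)
    next
      case clique
      then show ?thesis using M by (auto simp: N clique_packings_def)
    qed
  qed
qed

lemma stable_packings_blown_up_fork:
  "stable_packings (blown_up_fork k) = vxy_packings \<union> uvxy_packings \<union> clique_packings k"
proof (rule subset_antisym[OF stable_packings_blown_up_fork_subset subsetI])
  have vxy: "disjoint N \<and> N \<subseteq> outer_blocks \<and> (\<forall>B\<in>N. B \<inter> {Inl fork_u, Inr i} = {})"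
    if "N \<in> vxy_packings" for N i
    using that by (auto simp: vxy_packings_def outer_blocks_def)
  have uvxy: "disjoint N \<and> N \<subseteq> outer_blocks" if "N \<in> uvxy_packings" for N
    using that by (auto simp: uvxy_packings_def outer_blocks_def pairwise_insert disjnt_def)
  fix N assume "N \<in> vxy_packings \<union> uvxy_packings \<union> clique_packings k"
  then consider (vxy) "N \<in> vxy_packings" | (uvxy) "N \<in> uvxy_packings"
    | (clique) i M where "i \<le> k" "N = insert {Inl fork_u, Inr i} M" "M \<in> vxy_packings"
    by (auto simp: clique_packings_def)
  then show "N \<in> stable_packings (blown_up_fork k)"
    unfolding stable_packings_blown_up_fork_iff
  proof cases
    case (clique i M)
    then have "disjoint N"
      using vxy[OF clique(3), of i] by (auto simp: clique(2) pairwise_insert disjnt_def)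
    then show "disjoint N \<and> (\<forall>B\<in>N. B \<in> outer_blocks \<or> (\<exists>i\<le>k. B = {Inl fork_u, Inr i}))"
      using clique vxy[OF clique(3)] by blast
  qed (use vxy uvxy in blast)+
qed

lemma finite_packings: "finite vxy_packings" "finite uvxy_packings" "finite (clique_packings k)"
  unfolding clique_packings_def vxy_packings_def uvxy_packings_def
  by (intro finite_UN_I finite_imageI finite.intros finite_atMost)+

lemma packings_disjoint:
  "vxy_packings \<inter> uvxy_packings = {}"
  "(vxy_packings \<union> uvxy_packings) \<inter> clique_packings k = {}"
proof -
  define meets :: "(fork_vertex + nat) set set \<Rightarrow> (fork_vertex + nat) set \<Rightarrow> bool"
    where "meets N U \<longleftrightarrow> \<Union>N \<inter> U \<noteq> {}" for N U
  have "\<not> meets N {Inl fork_u}" if "N \<in> vxy_packings" for N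
    using that unfolding vxy_packings_def meets_def by (elim imageE insertE emptyE; simp)
  moreover have "meets N {Inl fork_u} \<and> \<not> meets N (range Inr)" if "N \<in> uvxy_packings" for N
    using that unfolding uvxy_packings_def meets_def
    by (elim imageE insertE emptyE; simp add: image_iff)
  moreover have "meets N {Inl fork_u} \<and> meets N (range Inr)" if "N \<in> clique_packings k" for N
    using that by (auto simp: meets_def clique_packings_def)
  ultimately show "vxy_packings \<inter> uvxy_packings = {}"
    "(vxy_packings \<union> uvxy_packings) \<inter> clique_packings k = {}"
    by blast+
qed

lemma content_block_sizes_vxy_packings:
  "content (content card) vxy_packings = {#{#}, {#2#}, {#2#}, {#2#}, {#3#}#}"
proof -
  define P :: "(fork_vertex + nat) set set set" where
    "P = image (image Inl) ` {{{fork_x, fork_y}}, {{fork_v, fork_x}}, {{fork_v, fork_y}},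
      {{fork_v, fork_x, fork_y}}}"
  have "content (content card) P = {#{#2#}, {#2#}, {#2#}, {#3#}#}"
    unfolding P_def by (simp add: set_eq_subset numeral_2_eq_2 numeral_3_eq_3)
  moreover have "{} \<notin> P" "finite P"
    by (auto simp: P_def)
  moreover have vxy_eq: "vxy_packings = insert {} P"
    by (auto simp: vxy_packings_def P_def)
  ultimately show ?thesis
    unfolding vxy_eq by (subst mset_set.insert) simp_all
qed

lemma content_block_sizes_uvxy_packings:
  "content (content card) uvxy_packings = {#{#2#}, {#2#}, {#3#}, {#2, 2#}, {#2, 2#}#}"
  unfolding uvxy_packings_def by (simp add: set_eq_subset numeral_2_eq_2 numeral_3_eq_3)

lemma card_clique_packings_block_sizes:
  "card {N \<in> clique_packings k. content card N = \<tau>}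
    = (k + 1) * card {N \<in> vxy_packings. add_mset 2 (content card N) = \<tau>}"
proof -
  let ?w = "\<lambda>i :: nat. {Inl fork_u, Inr i} :: (fork_vertex + nat) set"
  let ?S = "{N \<in> vxy_packings. add_mset 2 (content card N) = \<tau>}"
  have new: "?w i \<notin> N" "finite N" if "N \<in> vxy_packings" for i N
    using that by (auto simp: vxy_packings_def)
  have sizes: "content card (insert (?w i) N) = add_mset 2 (content card N)"
    if "N \<in> vxy_packings" for i N
    using new[OF that] by simp
  have "{N \<in> clique_packings k. content card N = \<tau>} = (\<lambda>(i, N). insert (?w i) N) ` ({..k} \<times> ?S)"
    unfolding clique_packings_def using sizes by auto
  moreover have "inj_on (\<lambda>(i, N). insert (?w i) N) ({..k} \<times> ?S)"
  proof (rule inj_onI, clarify)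
    fix i N j M assume N: "N \<in> vxy_packings" and M: "M \<in> vxy_packings"
      and inserted: "insert (?w i) N = insert (?w j) M"
    have "?w i \<in> insert (?w j) M" unfolding inserted[symmetric] by (rule insertI1)
    then have "?w i = ?w j" using new(1)[OF M] by (metis insertE)
    then have "i = j" by (simp add: doubleton_eq_iff)
    then show "i = j \<and> N = M"
      using inserted new(1)[OF N] new(1)[OF M] by (metis insert_ident)
  qed
  ultimately show ?thesis by (simp add: card_image card_cartesian_product)
qed

lemma card_stable_packings_blown_up_fork:
  fixes \<tau> :: "nat multiset"
  shows "card {N \<in> stable_packings (blown_up_fork k). content card N = \<tau>}
    = count {#{#}, {#2#}, {#2#}, {#2#}, {#3#}#} \<tau>
      + count {#{#2#}, {#2#}, {#3#}, {#2, 2#}, {#2, 2#}#} \<tau>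
      + (k + 1) * count {#{#2#}, {#2, 2#}, {#2, 2#}, {#2, 2#}, {#2, 3#}#} \<tau>"
proof -
  let ?sizes = "content card :: (fork_vertex + nat) set set \<Rightarrow> nat multiset"
  let ?S = "\<lambda>P. {N \<in> P. ?sizes N = \<tau>}"
  have "card (?S (P \<union> Q)) = card (?S P) + card (?S Q)"
    if "finite P" "finite Q" "P \<inter> Q = {}" for P Q
  proof -
    have "?S (P \<union> Q) = ?S P \<union> ?S Q" "?S P \<inter> ?S Q = {}" using that(3) by auto
    then show ?thesis using that(1,2) by (simp add: card_Un_disjoint)
  qed
  then have "card (?S (stable_packings (blown_up_fork k)))
      = card (?S vxy_packings) + card (?S uvxy_packings) + card (?S (clique_packings k))"
    unfolding stable_packings_blown_up_fork
    by (simp only: finite_Un finite_packings packings_disjoint simp_thms)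
  moreover have "card (?S (clique_packings k))
      = (k + 1) * count (image_mset (add_mset 2) (content ?sizes vxy_packings)) \<tau>"
    unfolding card_clique_packings_block_sizes
    by (simp only: multiset.map_comp comp_def count_content finite_packings)
  ultimately show ?thesis
    by (simp only: count_content[OF finite_packings(1), symmetric]
        count_content[OF finite_packings(2), symmetric]
        content_block_sizes_vxy_packings content_block_sizes_uvxy_packings
        image_mset_add_mset image_mset_empty)
qed

section \<open>Products of elementary symmetric functions by multiplicities\<close>

lemma elementary_coeff_permute:
  fixes m :: "'v :: linorder multiset"
  assumes p: "p permutes {..<n}"
  shows "elementary_coeff n (\<lambda>j. a (p j)) m = elementary_coeff n a m"
proof (induction m arbitrary: a rule: multiset_induct_remove_max)
  case empty
  have "(\<forall>j<n. a (p j) = 0) \<longleftrightarrow> (\<forall>i\<in>p ` {..<n}. a i = 0)" by auto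
  then show ?case by (simp add: elementary_coeff_empty permutes_image[OF p] Ball_def)
next
  case (add m M x)
  have M: "M \<notin># m" using add.hyps by blast
  have "shorten (\<lambda>j. a (p j)) J = (\<lambda>j. shorten a (p ` J) (p j))" for J
    using permutes_inj[OF p] by (auto simp: shorten_def inj_image_mem_iff)
  then show ?case
    using sum_subsets_image_permutes[OF p, where f = "\<lambda>J. elementary_coeff n (shorten a J) m"]
    by (simp add: elementary_coeff_add_new[OF M] add.IH)
qed

lemma elementary_coeff_last_0:
  assumes "a n = 0"
  shows "elementary_coeff (Suc n) a m = elementary_coeff n a m"
proof -
  have "{A. A \<subseteq> set_mset m \<and> int (card A) = a n} = {{}}"
    using assms by (auto dest: finite_subset[OF _ finite_set_mset])
  then show ?thesis by simp
qed

lemma elementary_coeff_last_1: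
  assumes "a n = 1"
  shows "elementary_coeff (Suc n) a m = (\<Sum>v\<in>set_mset m. elementary_coeff n a (m - {#v#}))"
proof -
  have "{A. A \<subseteq> set_mset m \<and> int (card A) = a n} = (\<lambda>v. {v}) ` set_mset m"
    using assms by (auto simp: card_1_singleton_iff)
  then show ?thesis by (simp add: sum.reindex)
qed

lemma elementary_coeff_Suc_0:
  "elementary_coeff (Suc 0) a m = of_bool ((\<forall>v. count m v \<le> 1) \<and> int (size m) = a 0)"
proof -
  have full: "A = set_mset m \<and> (\<forall>v. count m v \<le> 1)"
    if A: "A \<subseteq> set_mset m" "m - mset_set A = {#}" for A
  proof -
    have "finite A" by (rule finite_subset[OF A(1)]) simp
    have count_le: "count m v \<le> count (mset_set A) v" for v
      using A(2) by (metis Diff_eq_empty_iff_mset mset_subset_eq_count)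
    then have "set_mset m \<subseteq> A"
      using \<open>finite A\<close> by (metis count_greater_zero_iff count_mset_set(3) le_zero_eq not_gr_zero
            subsetI)
    moreover have "count m v \<le> 1" for v
      using count_le[of v] by (auto simp: count_mset_set' split: if_splits)
    ultimately show ?thesis using A(1) by auto
  qed
  show ?thesis
  proof (cases "\<forall>v. count m v \<le> 1")
    case True
    then have simple: "mset_set (set_mset m) = m"
      by (intro multiset_eqI) (auto simp: count_mset_set' le_Suc_eq count_eq_zero_iff)
    then have card: "card (set_mset m) = size m" by (metis size_mset_set)
    have "{A. A \<subseteq> set_mset m \<and> int (card A) = a 0 \<and> m - mset_set A = {#}}
        = {A. A = set_mset m \<and> int (size m) = a 0}"
      by (auto simp: simple card dest!: full)
    then show ?thesis using True by (simp add: conj_assoc Int_def)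
  next
    case False
    then have "elementary_coeff 0 a (m - mset_set A) = 0" if "A \<subseteq> set_mset m" for A
      using full[OF that] by auto
    then show ?thesis using False by simp
  qed
qed

lemma card_subsets_between:
  assumes "finite S" "finite D" "S \<inter> D = {}"
  shows "card {A. D \<subseteq> A \<and> A \<subseteq> S \<union> D \<and> card A = b}
    = (if card D \<le> b then card S choose (b - card D) else 0)"
proof (cases "card D \<le> b")
  case True
  have "bij_betw ((\<union>) D) {B. B \<subseteq> S \<and> card B = b - card D} {A. D \<subseteq> A \<and> A \<subseteq> S \<union> D \<and> card A = b}"
  proof (rule bij_betw_byWitness[where f' = "\<lambda>A. A - D"])
    have "card (D \<union> B) = card D + card B" if "B \<subseteq> S" for B
      using that assms finite_subset[OF that] by (intro card_Un_disjoint) auto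
    then show "(\<union>) D ` {B. B \<subseteq> S \<and> card B = b - card D} \<subseteq> {A. D \<subseteq> A \<and> A \<subseteq> S \<union> D \<and> card A = b}"
      using True by auto
    show "(\<lambda>A. A - D) ` {A. D \<subseteq> A \<and> A \<subseteq> S \<union> D \<and> card A = b} \<subseteq> {B. B \<subseteq> S \<and> card B = b - card D}"
      using assms(2) by (auto simp: card_Diff_subset)
  qed (use assms(3) in auto)
  then show ?thesis
    using True n_subsets[OF assms(1)] by (simp flip: bij_betw_same_card)
next
  case False
  have "card D \<le> card A" if "D \<subseteq> A" "A \<subseteq> S \<union> D" for A
    using that assms finite_subset[of A "S \<union> D"] by (intro card_mono) auto
  then have "{A. D \<subseteq> A \<and> A \<subseteq> S \<union> D \<and> card A = b} = {}" using False by auto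
  then show ?thesis using False by (simp only: card.empty if_False)
qed

text \<open>
  \<open>pair_coeff b \<mu>\<close> and \<open>triple_coeff b \<mu>\<close> are the coefficients of a monomial with multiplicities
  \<open>\<mu>\<close> in \<open>e\<^sub>a e\<^sub>b\<close> and \<open>e\<^sub>a e\<^sub>b e\<^sub>1\<close>, where \<open>a\<close> is determined by the degree.
\<close>

definition pair_coeff :: "nat \<Rightarrow> nat multiset \<Rightarrow> nat" where
  "pair_coeff b \<mu> =
     (if set_mset \<mu> \<subseteq> {1, 2} \<and> count \<mu> 2 \<le> b then count \<mu> 1 choose (b - count \<mu> 2) else 0)"

definition lower_part :: "nat \<Rightarrow> nat multiset \<Rightarrow> nat multiset" where
  "lower_part c \<mu> = \<mu> - {#c#} + (if c = 1 then {#} else {#c - 1#})"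

definition triple_coeff :: "nat \<Rightarrow> nat multiset \<Rightarrow> nat" where
  "triple_coeff b \<mu> = (\<Sum>c\<in>#\<mu>. pair_coeff b (lower_part c \<mu>))"

lemma count_multiplicities: "0 < i \<Longrightarrow> count (multiplicities m) i = card {v. count m v = i}"
  by (simp add: count_content) (metis (lifting) count_greater_zero_iff)

lemma simple_complement_iff:
  assumes "\<And>v. count m v \<le> 2" "A \<subseteq> set_mset m"
  shows "(\<forall>v. count (m - mset_set A) v \<le> 1) \<longleftrightarrow> {v. count m v = 2} \<subseteq> A"
proof -
  have "count (mset_set A) v = of_bool (v \<in> A)" for v
    using finite_subset[OF assms(2)] by (simp add: count_mset_set')
  then have "count (m - mset_set A) v \<le> 1 \<longleftrightarrow> (count m v = 2 \<longrightarrow> v \<in> A)" for v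
    using assms(1)[of v] by (cases "v \<in> A") auto
  then show ?thesis by blast
qed

lemma card_subsets_with_simple_complement:
  "card {A. A \<subseteq> set_mset m \<and> card A = b \<and> (\<forall>v. count (m - mset_set A) v \<le> 1)}
    = pair_coeff b (multiplicities m)"
proof (cases "\<forall>v. count m v \<le> 2")
  case True
  let ?D = "{v. count m v = 2}" and ?S = "{v. count m v = 1}"
  have "0 < count m v \<longleftrightarrow> count m v = 1 \<or> count m v = 2" for v
    using True[rule_format, of v] by linarith
  then have supp: "set_mset m = ?S \<union> ?D"
    by auto
  have "{A. A \<subseteq> set_mset m \<and> card A = b \<and> (\<forall>v. count (m - mset_set A) v \<le> 1)}
      = {A. ?D \<subseteq> A \<and> A \<subseteq> ?S \<union> ?D \<and> card A = b}"
    using simple_complement_iff[of m] True by (auto simp: supp)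
  moreover have "finite ?S" "finite ?D"
    using supp finite_set_mset[of m] by (metis finite_Un)+
  moreover have "count m v \<in> {1, 2}" if "v \<in># m" for v
    using that unfolding supp by blast
  then have "set_mset (multiplicities m) \<subseteq> {1, 2}"
    by (simp add: image_subset_iff)
  ultimately show ?thesis
    by (simp add: card_subsets_between pair_coeff_def count_multiplicities disjoint_iff)
next
  case False
  then obtain v where v: "count m v > 2" by (auto simp: not_le)
  then have "v \<in># m" by (simp flip: count_greater_zero_iff)
  then have "count m v \<in># multiplicities m" by simp
  then have "\<not> set_mset (multiplicities m) \<subseteq> {1, 2}" using v by auto
  moreover have "\<not> (\<forall>v. count (m - mset_set A) v \<le> 1)" if "A \<subseteq> set_mset m" for A
    using v finite_subset[OF that] by (auto simp: count_mset_set' intro!: exI[of _ v])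
  ultimately show ?thesis by (simp add: pair_coeff_def)
qed

lemma elementary_coeff_2:
  assumes size: "int (size m) = a 0 + a 1" and b: "a 1 = int b"
  shows "elementary_coeff 2 a m = int (pair_coeff b (multiplicities m))"
proof -
  have size_diff: "int (size (m - mset_set A)) = a 0" if "A \<subseteq> set_mset m" "card A = b" for A
  proof -
    have "mset_set A \<subseteq># m"
      using that(1) by (auto simp: subseteq_mset_def count_mset_set')
    then show ?thesis
      using that size b size_mset_mono[of "mset_set A" m] by (simp add: size_Diff_submset)
  qed
  have "elementary_coeff 2 a m
      = (\<Sum>A | A \<subseteq> set_mset m \<and> int (card A) = a 1. elementary_coeff (Suc 0) a (m - mset_set A))"
    by (simp add: numeral_2_eq_2)
  also have "\<dots> = (\<Sum>A | A \<subseteq> set_mset m \<and> card A = b. of_bool (\<forall>v. count (m - mset_set A) v \<le> 1))"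
    unfolding b using size_diff
    by (intro sum.cong) (auto simp only: elementary_coeff_Suc_0 of_nat_eq_iff simp_thms)
  also have "\<dots> = int (card {A. A \<subseteq> set_mset m \<and> card A = b \<and> (\<forall>v. count (m - mset_set A) v \<le> 1)})"
    by (simp add: Int_def conj_assoc)
  finally show ?thesis
    by (simp only: card_subsets_with_simple_complement)
qed

lemma multiplicities_add_mset:
  "multiplicities (add_mset v m)
    = add_mset (Suc (count m v)) (content (count m) (set_mset m - {v}))"
proof -
  have "content (count (add_mset v m)) (set_mset m - {v}) = content (count m) (set_mset m - {v})"
    by (rule content_cong) auto
  then show ?thesis
    using content_Diff[of "insert v (set_mset m)" "{v}" "count (add_mset v m)"] by simp
qed

lemma multiplicities_remove:
  assumes "v \<in># m"
  shows "multiplicities (m - {#v#}) = lower_part (count m v) (multiplicities m)"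
proof -
  obtain m' where m: "m = add_mset v m'" using multi_member_split[OF assms] by blast
  show ?thesis
  proof (cases "v \<in># m'")
    case True
    then have "multiplicities m' = add_mset (count m' v) (content (count m') (set_mset m' - {v}))"
      using content_Diff[of "set_mset m'" "{v}" "count m'"] by simp
    then show ?thesis
      unfolding m multiplicities_add_mset lower_part_def
      using True by (simp add: count_eq_zero_iff)
  next
    case False
    then show ?thesis
      unfolding m multiplicities_add_mset lower_part_def by (simp add: not_in_iff)
  qed
qed

lemma elementary_coeff_3_1:
  assumes size: "int (size m) = a 0 + a 1 + 1" and b: "a 1 = int b" and "a 2 = 1"
  shows "elementary_coeff 3 a m = int (triple_coeff b (multiplicities m))"
proof -
  have "elementary_coeff 3 a m = (\<Sum>v\<in>set_mset m. elementary_coeff 2 a (m - {#v#}))"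
    using elementary_coeff_last_1[of a 2 m] assms(3) by (simp add: numeral_3_eq_3)
  also have "\<dots> = (\<Sum>v\<in>set_mset m. int (pair_coeff b (lower_part (count m v) (multiplicities m))))"
  proof (rule sum.cong[OF refl])
    fix v assume v: "v \<in># m"
    then have "0 < size m" by (cases m) auto
    then have "int (size (m - {#v#})) = a 0 + a 1"
      using v size by (simp add: size_Diff_singleton)
    then show "elementary_coeff 2 a (m - {#v#})
        = int (pair_coeff b (lower_part (count m v) (multiplicities m)))"
      by (simp only: elementary_coeff_2[where b = b] b multiplicities_remove[OF v])
  qed
  also have "\<dots> = int (triple_coeff b (multiplicities m))"
    by (simp add: triple_coeff_def multiset.map_comp comp_def sum_unfold_sum_mset)
  finally show ?thesis .
qed

section \<open>Schur functions of shapes with at most three columns\<close>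

definition elementary_pair :: "int \<Rightarrow> int \<Rightarrow> 'v multiset \<Rightarrow> int" where
  "elementary_pair a b = elementary_coeff 2 ((!) [a, b])"

definition elementary_triple :: "int \<Rightarrow> int \<Rightarrow> int \<Rightarrow> 'v multiset \<Rightarrow> int" where
  "elementary_triple a b c = elementary_coeff 3 ((!) [a, b, c])"

lemma elementary_coeff_2_eq_pair: "elementary_coeff 2 a m = elementary_pair (a 0) (a 1) m"
  unfolding elementary_pair_def by (rule elementary_coeff_cong) (auto simp: less_2_cases_iff)

lemma elementary_coeff_3_eq_triple: "elementary_coeff 3 a m = elementary_triple (a 0) (a 1) (a 2) m"
  unfolding elementary_triple_def
  by (rule elementary_coeff_cong) (auto simp: less_Suc_eq numeral_3_eq_3 numeral_2_eq_2)

lemma elementary_pair_commute: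
  fixes m :: "'v :: linorder multiset"
  shows "elementary_pair a b m = elementary_pair b a m"
  using elementary_coeff_permute[OF permutes_swap_id[of 0 "{..<2}" 1], of "(!) [a, b]" m]
  by (simp add: elementary_coeff_2_eq_pair)

lemma
  fixes m :: "'v :: linorder multiset"
  shows elementary_triple_swap_12: "elementary_triple a b c m = elementary_triple b a c m"
    and elementary_triple_swap_23: "elementary_triple a b c m = elementary_triple a c b m"
  using elementary_coeff_permute[OF permutes_swap_id[of 0 "{..<3}" 1], of "(!) [a, b, c]" m]
    elementary_coeff_permute[OF permutes_swap_id[of 1 "{..<3}" 2], of "(!) [a, b, c]" m]
  by (simp_all add: elementary_coeff_3_eq_triple transpose_def)

lemma elementary_pair_neg: "a < 0 \<or> b < 0 \<Longrightarrow> elementary_pair a b m = 0"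
  unfolding elementary_pair_def
  using elementary_coeff_neg[of 0 2 "(!) [a, b]"] elementary_coeff_neg[of 1 2 "(!) [a, b]"] by auto

lemma elementary_triple_neg: "a < 0 \<or> b < 0 \<or> c < 0 \<Longrightarrow> elementary_triple a b c m = 0"
  unfolding elementary_triple_def
  using elementary_coeff_neg[of 0 3 "(!) [a, b, c]"] elementary_coeff_neg[of 1 3 "(!) [a, b, c]"]
    elementary_coeff_neg[of 2 3 "(!) [a, b, c]"] by auto

lemma elementary_triple_0: "elementary_triple a b 0 m = elementary_pair a b m"
  using elementary_coeff_last_0[of "(!) [a, b, 0]" 2 m]
    elementary_coeff_2_eq_pair[of "(!) [a, b, 0]" m]
  by (simp add: elementary_triple_def)

lemma elementary_triple_middle_0:
  fixes m :: "'v :: linorder multiset"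
  shows "elementary_triple a 0 c m = elementary_pair a c m"
  by (simp only: elementary_triple_swap_23[of a 0] elementary_triple_0)

lemma elementary_pair_eq_pair_coeff:
  "size m = a + b \<Longrightarrow> elementary_pair (int a) (int b) m = int (pair_coeff b (multiplicities m))"
  unfolding elementary_pair_def by (rule elementary_coeff_2) simp_all

lemma elementary_triple_eq_triple_coeff:
  "size m = a + b + 1
    \<Longrightarrow> elementary_triple (int a) (int b) 1 m = int (triple_coeff b (multiplicities m))"
  unfolding elementary_triple_def by (rule elementary_coeff_3_1) simp_all

lemma jacobi_trudi_2:
  "jacobi_trudi 2 a m = elementary_pair (a 0) (a 1) m - elementary_pair (a 1 - 1) (a 0 + 1) m"
proof -
  have set: "{..<2} = {0, 1 :: nat}" and "finite {1 :: nat}" "0 \<notin> {1 :: nat}"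
    by auto
  note insert = sum_over_permutations_insert[OF this(2,3)]
  show ?thesis
    unfolding jacobi_trudi_def set insert permutes_sing
    by (simp add: sign_swap_id sign_compose permutation_swap_id elementary_coeff_2_eq_pair)
qed

lemma jacobi_trudi_3:
  "jacobi_trudi 3 a m
    = elementary_triple (a 0) (a 1) (a 2) m - elementary_triple (a 0) (a 2 - 1) (a 1 + 1) m
    - elementary_triple (a 1 - 1) (a 0 + 1) (a 2) m
    + elementary_triple (a 1 - 1) (a 2 - 1) (a 0 + 2) m
    + elementary_triple (a 2 - 2) (a 0 + 1) (a 1 + 1) m
    - elementary_triple (a 2 - 2) (a 1) (a 0 + 2) m"
proof -
  have set: "{..<3} = {0, 1, 2 :: nat}" and "finite {1, 2 :: nat}" "0 \<notin> {1, 2 :: nat}"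
    and "finite {2 :: nat}" "1 \<notin> {2 :: nat}"
    by auto
  note insert = sum_over_permutations_insert[OF this(2,3)]
    sum_over_permutations_insert[OF this(4,5)]
  show ?thesis
    unfolding jacobi_trudi_def set insert permutes_sing
    by (simp add: sign_swap_id sign_compose permutation_swap_id elementary_coeff_3_eq_triple
        transpose_def add.commute)
qed

lemma finite_young_diagram: "finite (young_diagram \<mu>)"
proof -
  have "young_diagram \<mu> = Sigma {..<length \<mu>} (\<lambda>i. {..<\<mu> ! i})"
    by (auto simp: young_diagram_def)
  then show ?thesis by simp
qed

lemma schur_eq_card_ssyt:
  assumes "0 \<notin># m"
  shows "schur \<mu> m = of_nat (card (ssyt (young_diagram \<mu>) m))"
proof -
  have "{T. semistandard_tableau \<mu> T \<and> content T (young_diagram \<mu>) = m} = ssyt (young_diagram \<mu>) m"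
  proof (intro subset_antisym subsetI CollectI)
    fix T assume T: "T \<in> ssyt (young_diagram \<mu>) m"
    have "T z \<ge> 1" if "z \<in> young_diagram \<mu>" for z
      using ssyt_value_mem[OF finite_young_diagram T that] assms by (cases "T z") auto
    with T show "semistandard_tableau \<mu> T \<and> content T (young_diagram \<mu>) = m"
      by (auto simp: semistandard_tableau_def ssyt_def semistandard_on_def PiE_def)
  qed (auto simp: semistandard_tableau_def ssyt_def semistandard_on_def PiE_def)
  then show ?thesis by (simp add: schur_def)
qed

lemma schur_eq_jacobi_trudi:
  assumes "0 \<notin># m" "young_diagram \<mu> = column_diagram n a" "column_lengths n a"
  shows "schur \<mu> m = of_int (jacobi_trudi n a m)"
proof -
  have "schur \<mu> m = of_int (int (card (ssyt (young_diagram \<mu>) m)))"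
    by (simp add: schur_eq_card_ssyt[OF assms(1)])
  then show ?thesis
    by (simp only: assms(2) dual_jacobi_trudi[OF assms(3)])
qed

lemma schur_two_columns:
  assumes "0 \<notin># m"
  shows "schur (replicate b 2 @ replicate t 1) m
    = of_int (elementary_pair (int (b + t)) (int b) m
        - elementary_pair (int (b + t) + 1) (int b - 1) m)"
proof -
  let ?a = "(!) [int (b + t), int b]"
  have "young_diagram (replicate b 2 @ replicate t 1) = column_diagram 2 ?a"
    by (auto simp: young_diagram_def nth_append less_2_cases_iff split: if_splits)
  moreover have "column_lengths 2 ?a"
    by (auto simp: column_lengths_def monotone_on_def less_2_cases_iff)
  ultimately show ?thesis
    using schur_eq_jacobi_trudi[OF assms]
    by (simp add: jacobi_trudi_2 elementary_pair_commute[of "int b - 1"])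
qed

lemma schur_three_columns:
  assumes "0 \<notin># m"
  shows "schur ([3] @ replicate b 2 @ replicate t 1) m
    = of_int (elementary_triple (int (b + t) + 1) (int b + 1) 1 m
      - elementary_pair (int (b + t) + 1) (int b + 2) m
      - elementary_triple (int (b + t) + 2) (int b) 1 m
      + elementary_pair (int (b + t) + 3) (int b) m)"
proof -
  let ?a = "(!) [int (b + t) + 1, int b + 1, 1]"
  have "young_diagram ([3] @ replicate b 2 @ replicate t 1) = column_diagram 3 ?a"
    by (auto simp: young_diagram_def nth_append nth_Cons less_Suc_eq numeral_3_eq_3
      split: nat.splits if_splits)
  moreover have "column_lengths 3 ?a"
    by (auto simp: column_lengths_def monotone_on_def less_Suc_eq numeral_3_eq_3)
  ultimately have "schur ([3] @ replicate b 2 @ replicate t 1) m = of_int (jacobi_trudi 3 ?a m)"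
    by (rule schur_eq_jacobi_trudi[OF assms])
  also have "jacobi_trudi 3 ?a m = elementary_triple (int (b + t) + 1) (int b + 1) 1 m
      - elementary_triple (int (b + t) + 1) 0 (int b + 2) m
      - elementary_triple (int b) (int (b + t) + 2) 1 m
      + elementary_triple (int b) 0 (int (b + t) + 3) m"
    by (simp add: jacobi_trudi_3 elementary_triple_neg algebra_simps)
  also have "elementary_triple (int (b + t) + 1) 0 (int b + 2) m
      = elementary_pair (int (b + t) + 1) (int b + 2) m"
    by (rule elementary_triple_middle_0)
  also have "elementary_triple (int b) 0 (int (b + t) + 3) m
      = elementary_pair (int (b + t) + 3) (int b) m"
    by (simp only: elementary_triple_middle_0 elementary_pair_commute)
  also have "elementary_triple (int b) (int (b + t) + 2) 1 m
      = elementary_triple (int (b + t) + 2) (int b) 1 m"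
    by (rule elementary_triple_swap_12)
  finally show ?thesis .
qed

section \<open>The elementary expansion of the blown-up fork\<close>

definition parts_123 :: "nat \<Rightarrow> nat \<Rightarrow> nat \<Rightarrow> nat multiset" where
  "parts_123 s d t = replicate_mset s 1 + replicate_mset d 2 + replicate_mset t 3"

lemma count_parts_123:
  "count (parts_123 s d t) i = (if i = 1 then s else if i = 2 then d else if i = 3 then t else 0)"
  by (simp add: parts_123_def)

lemma parts_123_inject: "parts_123 s d t = parts_123 s' d' t' \<longleftrightarrow> s = s' \<and> d = d' \<and> t = t'"
proof
  assume same: "parts_123 s d t = parts_123 s' d' t'"
  show "s = s' \<and> d = d' \<and> t = t'"
    using arg_cong[OF same, of "\<lambda>\<mu>. count \<mu> 1"] arg_cong[OF same, of "\<lambda>\<mu>. count \<mu> 2"]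
      arg_cong[OF same, of "\<lambda>\<mu>. count \<mu> 3"] by (simp add: count_parts_123)
qed simp

lemma parts_123_cases:
  assumes "0 \<notin># \<mu>"
  obtains (small) s d t where "\<mu> = parts_123 s d t" | (large) c where "c \<in># \<mu>" "4 \<le> c"
proof (cases "\<forall>c\<in>#\<mu>. c \<le> 3")
  case True
  have "\<mu> = parts_123 (count \<mu> 1) (count \<mu> 2) (count \<mu> 3)"
  proof (rule multiset_eqI)
    fix i :: nat
    consider "i = 0" | "i = 1" | "i = 2" | "i = 3" | "4 \<le> i" by linarith
    then show "count \<mu> i = count (parts_123 (count \<mu> 1) (count \<mu> 2) (count \<mu> 3)) i"
      using assms True by cases (force simp: count_parts_123 count_eq_zero_iff)+
  qed
  then show ?thesis by (rule small)
next
  case False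
  then show ?thesis using large by (auto simp: not_le Suc_le_eq numeral_eq_Suc)
qed

lemma sum_mset_parts_123: "\<Sum>\<^sub># (parts_123 s d t) = s + 2 * d + 3 * t"
  by (simp add: parts_123_def sum_mset_replicate_mset)

lemma mult_fact_parts_123: "mult_fact (parts_123 s d t) = fact s * fact d * fact t"
proof -
  have add: "mult_fact (replicate_mset n i + \<mu>) = fact n * mult_fact \<mu>" if "i \<notin># \<mu>"
    for n and i :: nat and \<mu>
    using that by (induction n) (simp_all add: mult_fact_add_mset not_in_iff algebra_simps)
  have replicate: "mult_fact (replicate_mset n i) = fact n" for n and i :: nat
    using add[of i "{#}" n] by (simp add: mult_fact_def)
  show ?thesis
    by (simp add: parts_123_def add replicate add.assoc)
qed

lemma pair_coeff_parts_123:
  "pair_coeff b (parts_123 s d t) = (if t = 0 \<and> d \<le> b then s choose (b - d) else 0)"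
  by (auto simp: pair_coeff_def count_parts_123 parts_123_def)

lemma triple_coeff_parts_123:
  "triple_coeff b (parts_123 s d t) = s * pair_coeff b (parts_123 (s - 1) d t)
     + d * pair_coeff b (parts_123 (s + 1) (d - 1) t)
     + t * pair_coeff b (parts_123 s (d + 1) (t - 1))"
proof -
  have "0 < s \<Longrightarrow> lower_part 1 (parts_123 s d t) = parts_123 (s - 1) d t"
    "0 < d \<Longrightarrow> lower_part 2 (parts_123 s d t) = parts_123 (s + 1) (d - 1) t"
    "0 < t \<Longrightarrow> lower_part 3 (parts_123 s d t) = parts_123 s (d + 1) (t - 1)"
    by (auto intro!: multiset_eqI simp: lower_part_def count_parts_123)
  moreover have "triple_coeff b (parts_123 s d t)
      = s * pair_coeff b (lower_part 1 (parts_123 s d t))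
      + d * pair_coeff b (lower_part 2 (parts_123 s d t))
      + t * pair_coeff b (lower_part 3 (parts_123 s d t))"
    unfolding triple_coeff_def
    by (subst (1) parts_123_def) (simp add: sum_mset_replicate_mset)
  ultimately show ?thesis
    by (cases "s = 0"; cases "d = 0"; cases "t = 0") simp_all
qed

lemma pair_coeff_large_part: "c \<in># \<mu> \<Longrightarrow> 3 \<le> c \<Longrightarrow> pair_coeff b \<mu> = 0"
  by (auto simp: pair_coeff_def)

lemma triple_coeff_large_part:
  assumes "c \<in># \<mu>" "4 \<le> c"
  shows "triple_coeff b \<mu> = 0"
proof -
  have "\<exists>c'\<in>#lower_part i \<mu>. 3 \<le> c'" if "i \<in># \<mu>" for i
  proof (cases "i = c")
    case True
    then show ?thesis using assms by (auto simp: lower_part_def)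
  next
    case False
    then have "c \<in># lower_part i \<mu>"
      using assms(1) by (simp add: lower_part_def flip: count_greater_zero_iff)
    then show ?thesis using assms(2) by (intro bexI[of _ c]) auto
  qed
  then have "pair_coeff b (lower_part i \<mu>) = 0" if "i \<in># \<mu>" for i
    using that pair_coeff_large_part by blast
  then show ?thesis
    by (simp add: triple_coeff_def)
qed

lemma card_stable_packings_blown_up_fork_parts_123:
  "card {N \<in> stable_packings (blown_up_fork k).
      content card N = filter_mset ((\<le>) 2) (parts_123 s d t)}
    = (if (d, t) = (0, 0) then 1 else if (d, t) = (1, 0) then k + 6
       else if (d, t) = (2, 0) then 3 * k + 5 else if (d, t) = (0, 1) then 2
       else if (d, t) = (1, 1) then k + 1 else 0)"
proof -
  let ?p = "parts_123 0"
  have "filter_mset ((\<le>) 2) (parts_123 s d t) = ?p d t"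
    by (rule multiset_eqI) (simp add: count_parts_123)
  moreover have "{#} = ?p 0 0" "{#2#} = ?p 1 0" "{#3#} = ?p 0 1" "{#2, 2#} = ?p 2 0"
    "{#2, 3#} = ?p 1 1"
    by (simp_all add: parts_123_def numeral_2_eq_2)
  ultimately have "card {N \<in> stable_packings (blown_up_fork k).
        content card N = filter_mset ((\<le>) 2) (parts_123 s d t)}
      = count {#?p 0 0, ?p 1 0, ?p 1 0, ?p 1 0, ?p 0 1#} (?p d t)
      + count {#?p 1 0, ?p 1 0, ?p 0 1, ?p 2 0, ?p 2 0#} (?p d t)
      + (k + 1) * count {#?p 1 0, ?p 2 0, ?p 2 0, ?p 2 0, ?p 1 1#} (?p d t)"
    by (simp only: card_stable_packings_blown_up_fork)
  moreover consider (no_block) "d = 0" "t = 0" | (pair) "d = 1" "t = 0"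
    | (two_pairs) "d = 2" "t = 0" | (triple) "d = 0" "t = 1" | (triple_pair) "d = 1" "t = 1"
    | (none) "(d, t) \<notin> {(0, 0), (1, 0), (2, 0), (0, 1), (1, 1)}"
    by auto
  ultimately show ?thesis
    by cases (simp_all add: parts_123_inject)
qed

lemma card_stable_packings_blown_up_fork_large_part:
  assumes "c \<in># \<mu>" "4 \<le> c"
  shows "card {N \<in> stable_packings (blown_up_fork k). content card N = filter_mset ((\<le>) 2) \<mu>} = 0"
proof -
  let ?\<tau> = "filter_mset ((\<le>) 2) \<mu>"
  have "c \<in># ?\<tau>" using assms by simp
  then have "\<tau> \<noteq> ?\<tau>" if "\<forall>i\<in>#\<tau>. i < 4" for \<tau>
    using that assms(2) by (metis not_le)
  then show ?thesis
    by (simp add: card_stable_packings_blown_up_fork)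
qed

lemma int_choose_2_mult_2: "2 * int (n choose 2) = int n * (int n - 1)"
  by (induction n) (simp_all add: numeral_2_eq_2 algebra_simps)

lemma int_choose_3_mult_3: "3 * int (n choose 3) = (int n - 2) * int (n choose 2)"
proof (induction n)
  case (Suc n)
  then show ?case
    using int_choose_2_mult_2[of n] by (simp add: numeral_2_eq_2 numeral_3_eq_3 algebra_simps)
qed (simp add: numeral_3_eq_3 numeral_2_eq_2)

text \<open>The coefficient of a monomial with multiplicities \<open>\<mu>\<close> in \<open>X\<^sub>G / (k + 1)!\<close>, where \<open>G = F\<^sub>w\<^sup>(\<^sup>k\<^sup>)\<close>.\<close>

definition fork_elementary_coeff :: "nat \<Rightarrow> nat multiset \<Rightarrow> int" where
  "fork_elementary_coeff k \<mu> = int (triple_coeff 2 \<mu>) - 3 * int (pair_coeff 3 \<mu>)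
     + (int k + 2) * int (triple_coeff 1 \<mu>) + 4 * (int k + 1) * int (pair_coeff 2 \<mu>)
     + (int k ^ 3 + 5 * int k ^ 2 + 8 * int k + 7) * int (pair_coeff 1 \<mu>)
     + (int k + 1)\<^sup>2 * (int k + 5) * int (pair_coeff 0 \<mu>)"

lemma fork_elementary_coeff_singles:
  "fork_elementary_coeff k (parts_123 (k + 5) 0 0)
    = (int k + 5) * (int k + 4) * (int k + 3) * (int k + 2)"
proof -
  have coeffs: "int (triple_coeff 2 (parts_123 (k + 5) 0 0)) = (int k + 5) * int (k + 4 choose 2)"
    "int (triple_coeff 1 (parts_123 (k + 5) 0 0)) = (int k + 5) * (int k + 4)"
    "int (pair_coeff 3 (parts_123 (k + 5) 0 0)) = int (k + 5 choose 3)"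
    "int (pair_coeff 2 (parts_123 (k + 5) 0 0)) = int (k + 5 choose 2)"
    "int (pair_coeff 1 (parts_123 (k + 5) 0 0)) = int k + 5"
    "int (pair_coeff 0 (parts_123 (k + 5) 0 0)) = 1"
    by (simp_all add: triple_coeff_parts_123 pair_coeff_parts_123 add.commute)
  have "2 * int (k + 4 choose 2) = (int k + 4) * (int k + 3)"
    "2 * int (k + 5 choose 2) = (int k + 5) * (int k + 4)"
    "3 * int (k + 5 choose 3) = (int k + 3) * int (k + 5 choose 2)"
    using int_choose_2_mult_2[of "k + 4"] int_choose_2_mult_2[of "k + 5"]
      int_choose_3_mult_3[of "k + 5"]
    by simp_all
  then show ?thesis
    unfolding fork_elementary_coeff_def coeffs by algebra
qed

lemma fork_elementary_coeff_one_pair: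
  "fork_elementary_coeff k (parts_123 (k + 3) 1 0) = (int k + 3) * (int k + 2) * (int k + 6)"
proof -
  have coeffs: "int (triple_coeff 2 (parts_123 (k + 3) 1 0))
      = (int k + 3) * (int k + 2) + int (k + 4 choose 2)"
    "int (triple_coeff 1 (parts_123 (k + 3) 1 0)) = 2 * int k + 7"
    "int (pair_coeff 3 (parts_123 (k + 3) 1 0)) = int (k + 3 choose 2)"
    "int (pair_coeff 2 (parts_123 (k + 3) 1 0)) = int k + 3"
    "int (pair_coeff 1 (parts_123 (k + 3) 1 0)) = 1"
    "int (pair_coeff 0 (parts_123 (k + 3) 1 0)) = 0"
    by (simp_all add: triple_coeff_parts_123 pair_coeff_parts_123 add.commute algebra_simps
      del: binomial_Suc_Suc)
  have "2 * int (k + 4 choose 2) = (int k + 4) * (int k + 3)"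
    "2 * int (k + 3 choose 2) = (int k + 3) * (int k + 2)"
    using int_choose_2_mult_2[of "k + 4"] int_choose_2_mult_2[of "k + 3"] by simp_all
  then show ?thesis
    unfolding fork_elementary_coeff_def coeffs by algebra
qed

lemma fork_elementary_coeff_eq_0:
  assumes "(d, t) \<notin> {(0, 0), (1, 0), (2, 0), (0, 1), (1, 1)}"
  shows "fork_elementary_coeff k (parts_123 s d t) = 0"
proof -
  consider (three_pairs) "t = 0" "d = 3" | (four_pairs) "t = 0" "4 \<le> d"
    | (triple_two_pairs) "t = 1" "2 \<le> d" | (two_triples) "2 \<le> t"
  proof -
    have "d \<notin> {0, 1, 2}" if "t = 0" using assms that by auto
    moreover have "d \<notin> {0, 1}" if "t = 1" using assms that by auto
    ultimately show ?thesis using that by (simp add: numeral_eq_Suc) linarith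
  qed
  then show ?thesis
  proof cases
    case four_pairs
    then have "\<not> d \<le> b" "\<not> d - 1 \<le> b" if "b \<le> 2" for b using that by linarith+
    moreover have "\<not> d \<le> 3" using four_pairs by simp
    ultimately show ?thesis
      using four_pairs by (simp add: fork_elementary_coeff_def triple_coeff_parts_123
          pair_coeff_parts_123)
  qed (simp_all add: fork_elementary_coeff_def triple_coeff_parts_123 pair_coeff_parts_123)
qed

lemma mult_fact_times_card_stable_packings_blown_up_fork:
  assumes sum: "s + 2 * d + 3 * t = k + 5"
  defines "\<mu> \<equiv> parts_123 s d t"
  shows "int (mult_fact \<mu>
      * card {N \<in> stable_packings (blown_up_fork k). content card N = filter_mset ((\<le>) 2) \<mu>})
    = fact (k + 1) * fork_elementary_coeff k \<mu>"
proof -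
  note packings = \<mu>_def mult_fact_parts_123 card_stable_packings_blown_up_fork_parts_123
  note coeff = fork_elementary_coeff_def triple_coeff_parts_123 pair_coeff_parts_123
  have fact: "fact (k + 3) = (int k + 3) * (int k + 2) * fact (k + 1)"
    "fact (k + 5) = (int k + 5) * (int k + 4) * (int k + 3) * (int k + 2) * fact (k + 1)"
    by (simp_all add: eval_nat_numeral algebra_simps)
  consider (singles) "d = 0" "t = 0" "s = k + 5" | (pair) "d = 1" "t = 0" "s = k + 3"
    | (two_pairs) "d = 2" "t = 0" "s = k + 1" | (triple) "d = 0" "t = 1" "s = k + 2"
    | (triple_pair) "d = 1" "t = 1" "s = k"
    | (none) "(d, t) \<notin> {(0, 0), (1, 0), (2, 0), (0, 1), (1, 1)}"
    using sum
    by (cases "(d, t) \<in> {(0, 0), (1, 0), (2, 0), (0, 1), (1, 1)}") (elim insertE, auto)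
  then show ?thesis
  proof cases
    case singles
    then show ?thesis by (simp add: packings fork_elementary_coeff_singles fact del: fact_Suc)
  next
    case pair
    then show ?thesis
      by (simp add: packings fork_elementary_coeff_one_pair fact del: fact_Suc One_nat_def)
  next
    case two_pairs
    then show ?thesis by (simp add: packings coeff algebra_simps del: fact_Suc)
  next
    case triple
    then show ?thesis by (simp add: packings coeff algebra_simps)
  next
    case triple_pair
    then show ?thesis by (simp add: packings coeff algebra_simps)
  next
    case none
    then show ?thesis by (simp add: packings fork_elementary_coeff_eq_0)
  qed
qed

lemma chromatic_sym_blown_up_fork_multiplicities:
  assumes m: "0 \<notin># m" and size: "size m = k + 5"
  shows "chromatic_sym (blown_up_fork k) m
    = fact (k + 1) * of_int (fork_elementary_coeff k (multiplicities m))"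
proof -
  let ?\<mu> = "multiplicities m"
  have chromatic: "chromatic_sym (blown_up_fork k) m = of_int (int (mult_fact ?\<mu>
      * card {N \<in> stable_packings (blown_up_fork k). content card N = filter_mset ((\<le>) 2) ?\<mu>}))"
    using chromatic_sym_eq_stable_packings[OF finite_simple_graph_blown_up_fork m]
    by (simp add: size card_verts_blown_up_fork)
  have "0 \<notin># ?\<mu>" by (auto simp: count_eq_zero_iff)
  then show ?thesis
  proof (cases rule: parts_123_cases)
    case (small s d t)
    then have "s + 2 * d + 3 * t = k + 5"
      using sum_mset_multiplicities[of m] by (simp add: size sum_mset_parts_123)
    then show ?thesis
      unfolding chromatic small
      by (simp only: mult_fact_times_card_stable_packings_blown_up_fork of_int_mult of_int_fact)
  next
    case (large c)
    then have "pair_coeff b ?\<mu> = 0" "triple_coeff b ?\<mu> = 0" for b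
      using pair_coeff_large_part[of c] triple_coeff_large_part[of c] by simp_all
    then show ?thesis
      unfolding chromatic card_stable_packings_blown_up_fork_large_part[OF large]
      by (simp add: fork_elementary_coeff_def)
  qed
qed

theorem chromatic_sym_blown_up_fork_elementary:
  assumes m: "0 \<notin># m" and size: "size m = k + 5"
  shows "chromatic_sym (blown_up_fork k) m = fact (k + 1) * of_int
    (elementary_triple (int k + 2) 2 1 m - 3 * elementary_pair (int k + 2) 3 m
      + (int k + 2) * elementary_triple (int k + 3) 1 1 m
      + 4 * (int k + 1) * elementary_pair (int k + 3) 2 m
      + (int k ^ 3 + 5 * int k ^ 2 + 8 * int k + 7) * elementary_pair (int k + 4) 1 m
      + (int k + 1)\<^sup>2 * (int k + 5) * elementary_pair (int k + 5) 0 m)"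
proof -
  have "elementary_triple (int k + 2) 2 1 m = int (triple_coeff 2 (multiplicities m))"
    "elementary_triple (int k + 3) 1 1 m = int (triple_coeff 1 (multiplicities m))"
    "elementary_pair (int k + 2) 3 m = int (pair_coeff 3 (multiplicities m))"
    "elementary_pair (int k + 3) 2 m = int (pair_coeff 2 (multiplicities m))"
    "elementary_pair (int k + 4) 1 m = int (pair_coeff 1 (multiplicities m))"
    "elementary_pair (int k + 5) 0 m = int (pair_coeff 0 (multiplicities m))"
    using elementary_triple_eq_triple_coeff[of m "k + 2" 2]
      elementary_triple_eq_triple_coeff[of m "k + 3" 1]
      elementary_pair_eq_pair_coeff[of m "k + 2" 3] elementary_pair_eq_pair_coeff[of m "k + 3" 2]
      elementary_pair_eq_pair_coeff[of m "k + 4" 1] elementary_pair_eq_pair_coeff[of m "k + 5" 0]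
    by (simp_all add: size add.commute)
  then show ?thesis
    by (simp only: chromatic_sym_blown_up_fork_multiplicities[OF m size] fork_elementary_coeff_def)
qed

section \<open>Linear independence of the Schur functions\<close>

text \<open>The content of the tableau of shape \<open>\<mu>\<close> whose row \<open>i\<close> consists of entries \<open>i + 1\<close>.\<close>

definition row_content :: "nat list \<Rightarrow> nat multiset" where
  "row_content \<mu> = (\<Sum>i<length \<mu>. replicate_mset (\<mu> ! i) (Suc i))"

definition dominates :: "nat list \<Rightarrow> nat list \<Rightarrow> bool" where
  "dominates \<mu> \<nu> \<longleftrightarrow> (\<forall>k. sum_list (take k \<nu>) \<le> sum_list (take k \<mu>))"

lemma count_row_content: "count (row_content \<mu>) (Suc i) = (if i < length \<mu> then \<mu> ! i else 0)"
  by (simp add: row_content_def count_sum)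

lemma zero_notin_row_content: "0 \<notin># row_content \<mu>"
  by (simp add: row_content_def not_in_iff count_sum)

lemma sum_list_take: "sum_list (take k \<mu>) = (\<Sum>i<min k (length \<mu>). \<mu> ! i)"
  by (simp add: sum_list_sum_nth atLeast0LessThan min.commute)

lemma card_young_diagram_rows:
  "card {(i, j) \<in> young_diagram \<mu>. i < k} = sum_list (take k \<mu>)"
proof -
  have "{(i, j) \<in> young_diagram \<mu>. i < k} = Sigma {..<min k (length \<mu>)} (\<lambda>i. {..<\<mu> ! i})"
    by (auto simp: young_diagram_def)
  then show ?thesis by (simp add: sum_list_take)
qed

lemma size_filter_row_content:
  "size (filter_mset (\<lambda>v. v \<le> k) (row_content \<mu>)) = sum_list (take k \<mu>)"
proof -
  have "filter_mset (\<lambda>v. v \<le> k) (row_content \<mu>)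
      = (\<Sum>i<min k (length \<mu>). replicate_mset (\<mu> ! i) (Suc i))"
  proof (rule multiset_eqI)
    fix v
    show "count (filter_mset (\<lambda>v. v \<le> k) (row_content \<mu>)) v
        = count (\<Sum>i<min k (length \<mu>). replicate_mset (\<mu> ! i) (Suc i)) v"
      by (cases v) (simp_all add: row_content_def count_sum)
  qed
  moreover have "size (\<Sum>i<n. replicate_mset (\<mu> ! i) (Suc i)) = (\<Sum>i<n. \<mu> ! i)" for n
    by (induction n) simp_all
  ultimately show ?thesis by (simp add: sum_list_take)
qed

lemma dominates_if_schur_neq_0:
  assumes "is_partition \<mu>" "schur \<mu> (row_content \<nu>) \<noteq> 0"
  shows "dominates \<mu> \<nu>"
proof -
  let ?Y = "young_diagram \<mu>"
  have "ssyt ?Y (row_content \<nu>) \<noteq> {}"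
    using assms(2) by (auto simp: schur_eq_card_ssyt[OF zero_notin_row_content])
  then obtain T where T: "T \<in> ssyt ?Y (row_content \<nu>)" by blast
  have row_less: "i < T (i, j)" if "(i, j) \<in> ?Y" for i j
    using that
  proof (induction i)
    case 0
    then have "T (0, j) \<in># row_content \<nu>" by (rule ssyt_value_mem[OF finite_young_diagram T])
    then show ?case using zero_notin_row_content by (metis gr0I)
  next
    case (Suc i)
    then have cell: "Suc i < length \<mu>" "j < \<mu> ! Suc i"
      by (simp_all add: young_diagram_def)
    moreover have "\<mu> ! Suc i \<le> \<mu> ! i"
      using assms(1) sorted_wrt_nth_less[of "(\<ge>)" \<mu> i "Suc i"] cell(1)
      by (simp add: is_partition_def)
    ultimately have "(i, j) \<in> ?Y" by (simp add: young_diagram_def)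
    then show ?case
      using Suc ssyt_column_strict_mono[OF T, of i j "Suc i"] by simp
  qed
  show ?thesis
    unfolding dominates_def
  proof
    fix k
    have "sum_list (take k \<nu>) = size (filter_mset (\<lambda>v. v \<le> k) (content T ?Y))"
      using T by (simp add: ssyt_def size_filter_row_content)
    also have "\<dots> = card {z \<in> ?Y. T z \<le> k}"
      using finite_young_diagram by (simp add: filter_mset_image_mset)
    also have "\<dots> \<le> card {(i, j) \<in> ?Y. i < k}"
      using row_less finite_young_diagram
      by (intro card_mono) (auto intro: order.strict_trans2 finite_subset)
    finally show "sum_list (take k \<nu>) \<le> sum_list (take k \<mu>)"
      by (simp only: card_young_diagram_rows)
  qed
qed

lemma schur_row_content_neq_0:
  "schur \<mu> (row_content \<mu>) \<noteq> 0"
proof -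
  let ?Y = "young_diagram \<mu>"
  let ?T = "restrict (\<lambda>(i, j). Suc i) ?Y"
  have "content ?T ?Y = row_content \<mu>"
  proof (rule multiset_eqI)
    fix v
    have "count (content ?T ?Y) v = card {z \<in> ?Y. Suc (fst z) = v}"
      unfolding count_content[OF finite_young_diagram] by (intro arg_cong[where f = card]) auto
    also have "\<dots> = count (row_content \<mu>) v"
    proof (cases v)
      case (Suc i)
      have "{z \<in> ?Y. Suc (fst z) = Suc i} = (if i < length \<mu> then Pair i ` {..<\<mu> ! i} else {})"
        by (auto simp: young_diagram_def)
      then show ?thesis by (simp add: Suc count_row_content card_image inj_on_def)
    qed (use zero_notin_row_content in \<open>simp add: not_in_iff\<close>)
    finally show "count (content ?T ?Y) v = count (row_content \<mu>) v" .
  qed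
  then have "?T \<in> ssyt ?Y (row_content \<mu>)"
    by (auto simp: ssyt_def semistandard_on_def)
  then have "card (ssyt ?Y (row_content \<mu>)) \<noteq> 0"
    using finite_ssyt[OF finite_young_diagram] by (auto simp: card_eq_0_iff)
  then show ?thesis
    by (simp add: schur_eq_card_ssyt[OF zero_notin_row_content])
qed

lemma dominates_antisym:
  assumes "is_partition \<mu>" "is_partition \<nu>" "dominates \<mu> \<nu>" "dominates \<nu> \<mu>"
  shows "\<mu> = \<nu>"
proof -
  have take: "sum_list (take k \<mu>) = sum_list (take k \<nu>)" for k
    using assms(3,4) by (simp add: dominates_def le_antisym)
  have entry: "sum_list (take (Suc i) \<rho>)
      = sum_list (take i \<rho>) + (if i < length \<rho> then \<rho> ! i else 0)"
    for i and \<rho> :: "nat list"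
    by (simp add: take_Suc_conv_app_nth)
  have same_entry:
    "(if i < length \<mu> then \<mu> ! i else 0) = (if i < length \<nu> then \<nu> ! i else 0)" for i
    using take[of i] take[of "Suc i"] entry[of i \<mu>] entry[of i \<nu>] by linarith
  have pos_\<mu>: "0 < \<mu> ! i" if "i < length \<mu>" for i
    using assms(1) nth_mem[OF that] by (force simp: is_partition_def)
  have pos_\<nu>: "0 < \<nu> ! i" if "i < length \<nu>" for i
    using assms(2) nth_mem[OF that] by (force simp: is_partition_def)
  have "i < length \<mu> \<longleftrightarrow> i < length \<nu>" for i
    using same_entry[of i] pos_\<mu>[of i] pos_\<nu>[of i] by (auto split: if_splits)
  then have "length \<mu> = length \<nu>" by (metis nat_neq_iff)
  then show ?thesis
    using same_entry by (intro nth_equalityI) (simp, metis)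
qed

theorem schur_linear_independent:
  assumes P: "finite P" "\<And>\<mu>. \<mu> \<in> P \<Longrightarrow> is_partition \<mu>"
    and zero: "\<And>m. (\<Sum>\<mu>\<in>P. c \<mu> * schur \<mu> m) = 0" and "\<mu> \<in> P"
  shows "c \<mu> = 0"
proof (rule ccontr)
  assume "c \<mu> \<noteq> 0"
  let ?Q = "{\<mu> \<in> P. c \<mu> \<noteq> 0}"
  let ?below = "\<lambda>\<nu> \<mu>. \<mu> \<noteq> \<nu> \<and> dominates \<mu> \<nu>"
  have "transp_on ?Q ?below"
  proof (rule transp_onI)
    fix x y z assume Q: "x \<in> ?Q" "y \<in> ?Q" "z \<in> ?Q" and "?below x y" "?below y z"
    then have "dominates z x" by (auto simp: dominates_def intro: order.trans)
    moreover have "z \<noteq> x"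
      using Q P(2) dominates_antisym \<open>?below x y\<close> \<open>?below y z\<close> by blast
    ultimately show "?below x z" by blast
  qed
  moreover have "asymp_on ?Q ?below"
    using P(2) dominates_antisym by (intro asymp_onI) blast
  ultimately obtain \<nu> where \<nu>: "\<nu> \<in> ?Q" and max: "\<And>\<mu>. \<mu> \<in> ?Q \<Longrightarrow> \<mu> \<noteq> \<nu> \<Longrightarrow> \<not> ?below \<nu> \<mu>"
    using Finite_Set.bex_max_element[of ?Q ?below] P(1) \<open>\<mu> \<in> P\<close> \<open>c \<mu> \<noteq> 0\<close> by auto
  have "(\<Sum>\<mu>\<in>P. c \<mu> * schur \<mu> (row_content \<nu>)) = (\<Sum>\<mu>\<in>{\<nu>}. c \<mu> * schur \<mu> (row_content \<nu>))"
  proof (rule sum.mono_neutral_right[OF P(1)])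
    show "\<forall>\<mu>\<in>P - {\<nu>}. c \<mu> * schur \<mu> (row_content \<nu>) = 0"
      using max dominates_if_schur_neq_0 P(2) by fastforce
  qed (use \<nu> in simp)
  then show False
    using zero \<nu> schur_row_content_neq_0 by simp
qed

corollary schur_positive_coeff_nonneg:
  assumes P: "finite P" "\<And>\<mu>. \<mu> \<in> P \<Longrightarrow> is_partition \<mu>"
    and positive: "schur_positive (\<lambda>m. \<Sum>\<mu>\<in>P. c \<mu> * schur \<mu> m)" and "\<mu> \<in> P"
  shows "c \<mu> \<ge> 0"
proof -
  obtain c' where c': "schur_expansion c' (\<lambda>m. \<Sum>\<mu>\<in>P. c \<mu> * schur \<mu> m)" "\<And>\<mu>. c' \<mu> \<ge> 0"
    using positive unfolding schur_positive_def by blast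
  let ?c = "\<lambda>\<mu>. if \<mu> \<in> P then c \<mu> else 0"
  let ?P' = "P \<union> {\<mu>. c' \<mu> \<noteq> 0}"
  have fin: "finite ?P'" and part: "\<And>\<mu>. \<mu> \<in> ?P' \<Longrightarrow> is_partition \<mu>"
    using c'(1) P by (auto simp: schur_expansion_def)
  have "(\<Sum>\<mu>\<in>?P'. (?c \<mu> - c' \<mu>) * schur \<mu> m) = 0" for m
  proof -
    have "(\<Sum>\<mu>\<in>?P'. ?c \<mu> * schur \<mu> m) = (\<Sum>\<mu>\<in>P. c \<mu> * schur \<mu> m)"
      using fin by (intro sum.mono_neutral_cong_right) auto
    also have "\<dots> = (\<Sum>\<mu> | c' \<mu> \<noteq> 0. c' \<mu> * schur \<mu> m)"
      using c'(1) unfolding schur_expansion_def by meson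
    also have "\<dots> = (\<Sum>\<mu>\<in>?P'. c' \<mu> * schur \<mu> m)"
      using fin by (intro sum.mono_neutral_left) auto
    finally show ?thesis by (simp add: left_diff_distrib sum_subtractf)
  qed
  then have "?c \<mu> - c' \<mu> = 0"
    using schur_linear_independent[OF fin part, of "\<lambda>\<mu>. ?c \<mu> - c' \<mu>" \<mu>] \<open>\<mu> \<in> P\<close> by blast
  then show ?thesis using c'(2)[of \<mu>] \<open>\<mu> \<in> P\<close> by simp
qed

section \<open>The Schur expansion of the blown-up fork\<close>

lemma content_positive:
  fixes f :: "'a \<Rightarrow> nat"
  assumes "f \<in> D \<rightarrow>\<^sub>E {1..}" "finite D"
  shows "0 \<notin># content f D" "size (content f D) = card D"
proof -
  have "f z \<noteq> 0" if "z \<in> D" for z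
    using PiE_mem[OF assms(1) that] by simp
  then show "0 \<notin># content f D" using assms(2) by force
qed (simp add: assms(2))

lemma schur_eq_0:
  assumes "0 \<in># m \<or> size m \<noteq> card (young_diagram \<mu>)"
  shows "schur \<mu> m = 0"
proof -
  have "content T (young_diagram \<mu>) \<noteq> m" if "semistandard_tableau \<mu> T" for T
    using assms content_positive[of T "young_diagram \<mu>"] finite_young_diagram[of \<mu>] that
    unfolding semistandard_tableau_def by blast
  then have "{T. semistandard_tableau \<mu> T \<and> content T (young_diagram \<mu>) = m} = {}" by blast
  then show ?thesis by (simp only: schur_def card.empty of_nat_0)
qed

lemma chromatic_sym_eq_0:
  assumes "finite (verts G)" "0 \<in># m \<or> size m \<noteq> card (verts G)"
  shows "chromatic_sym G m = 0"
proof -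
  have "content \<kappa> (verts G) \<noteq> m" if "proper_coloring G \<kappa>" for \<kappa>
    using assms content_positive[of \<kappa> "verts G"] that unfolding proper_coloring_def by blast
  then have "{\<kappa>. proper_coloring G \<kappa> \<and> content \<kappa> (verts G) = m} = {}" by blast
  then show ?thesis by (simp only: chromatic_sym_def card.empty of_nat_0)
qed

lemma card_young_diagram: "card (young_diagram \<mu>) = sum_list \<mu>"
  using card_young_diagram_rows[of \<mu> "length \<mu>"]
  by (simp add: young_diagram_def case_prod_beta conj_assoc cong: conj_cong)

lemma schur_blown_up_fork_shapes:
  assumes m: "0 \<notin># m" and k: "k \<ge> 1"
  shows "schur ([3, 2] @ replicate k 1) m = of_int (elementary_triple (int k + 2) 2 1 m
      - elementary_pair (int k + 2) 3 m - elementary_triple (int k + 3) 1 1 m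
      + elementary_pair (int k + 4) 1 m)"
    and "schur ([3] @ replicate (k + 2) 1) m = of_int (elementary_triple (int k + 3) 1 1 m
      - elementary_pair (int k + 3) 2 m - elementary_pair (int k + 4) 1 m
      + elementary_pair (int k + 5) 0 m)"
    and "schur (replicate 3 2 @ replicate (k - 1) 1) m
      = of_int (elementary_pair (int k + 2) 3 m - elementary_pair (int k + 3) 2 m)"
    and "schur (replicate 2 2 @ replicate (k + 1) 1) m
      = of_int (elementary_pair (int k + 3) 2 m - elementary_pair (int k + 4) 1 m)"
    and "schur ([2] @ replicate (k + 3) 1) m
      = of_int (elementary_pair (int k + 4) 1 m - elementary_pair (int k + 5) 0 m)"
    and "schur (replicate (k + 5) 1) m = of_int (elementary_pair (int k + 5) 0 m)"
  using schur_three_columns[OF m, of 1 k] schur_three_columns[OF m, of 0 "k + 2"]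
    schur_two_columns[OF m, of 3 "k - 1"] schur_two_columns[OF m, of 2 "k + 1"]
    schur_two_columns[OF m, of 1 "k + 3"] schur_two_columns[OF m, of 0 "k + 5"] k
  by (simp_all add: add.commute elementary_triple_middle_0 elementary_pair_neg)

definition fork_expansion :: "nat \<Rightarrow> (nat list \<times> rat) list" where
  "fork_expansion k =
     [([3, 2] @ replicate k 1, fact (k + 1)),
      ([3] @ replicate (k + 2) 1, (of_nat k + 3) * fact (k + 1)),
      (replicate 3 2 @ replicate (k - 1) 1, - 2 * fact (k + 1)),
      (replicate 2 2 @ replicate (k + 1) 1, 5 * (of_nat k + 1) * fact (k + 1)),
      ([2] @ replicate (k + 3) 1, (of_nat k ^ 3 + 5 * of_nat k ^ 2 + 14 * of_nat k + 14)
        * fact (k + 1)),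
      (replicate (k + 5) 1, 2 * (of_nat k + 2) ^ 3 * fact (k + 1))]"

lemma fork_expansion_partition:
  assumes "k \<ge> 1" "(\<mu>, c) \<in> set (fork_expansion k)"
  shows "is_partition \<mu>" "sum_list \<mu> = k + 5"
proof -
  have "sorted_wrt (\<ge>) (replicate n x)" for n x :: nat
    by (induction n) auto
  then show "is_partition \<mu>" "sum_list \<mu> = k + 5"
    using assms by (auto simp: fork_expansion_def sum_list_replicate is_partition_def
        sorted_wrt_append)
qed

lemma distinct_fork_expansion:
  assumes "k \<ge> 1"
  shows "distinct (map fst (fork_expansion k))"
proof -
  have "distinct (map (\<lambda>\<mu>. (hd \<mu>, length \<mu>)) (map fst (fork_expansion k)))"
    using assms by (simp add: fork_expansion_def numeral_2_eq_2 numeral_3_eq_3)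
  then show ?thesis by (rule distinct_map[THEN iffD1, THEN conjunct1])
qed

theorem chromatic_sym_blown_up_fork_schur:
  assumes k: "k \<ge> 1"
  shows "chromatic_sym (blown_up_fork k) m = (\<Sum>(\<mu>, c)\<leftarrow>fork_expansion k. c * schur \<mu> m)"
proof (cases "0 \<notin># m \<and> size m = k + 5")
  case True
  then have m: "0 \<notin># m" "size m = k + 5" by auto
  show ?thesis
    unfolding chromatic_sym_blown_up_fork_elementary[OF m] fork_expansion_def list.map prod.case
      schur_blown_up_fork_shapes[OF m(1) k]
    by (simp add: algebra_simps power2_eq_square power3_eq_cube del: fact_Suc)
next
  case False
  then have "schur \<mu> m = 0" if "(\<mu>, c) \<in> set (fork_expansion k)" for \<mu> c
    using fork_expansion_partition(2)[OF k that]
    by (intro schur_eq_0) (auto simp: card_young_diagram)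
  then have "(\<Sum>(\<mu>, c)\<leftarrow>fork_expansion k. c * schur \<mu> m) = 0"
    by (subst map_cong[OF refl, where g = "\<lambda>_. 0"]) auto
  moreover have "finite (verts (blown_up_fork k))"
    using finite_simple_graph_blown_up_fork by (simp add: finite_simple_graph_def)
  then have "chromatic_sym (blown_up_fork k) m = 0"
    using False by (intro chromatic_sym_eq_0) (auto simp: card_verts_blown_up_fork)
  ultimately show ?thesis by simp
qed

lemma schur_positive_list_coeff_nonneg:
  assumes distinct: "distinct (map fst xs)" and part: "\<And>\<mu> c. (\<mu>, c) \<in> set xs \<Longrightarrow> is_partition \<mu>"
    and positive: "schur_positive (\<lambda>m. \<Sum>(\<mu>, c)\<leftarrow>xs. c * schur \<mu> m)" and mem: "(\<mu>, c) \<in> set xs"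
  shows "c \<ge> 0"
proof -
  let ?c = "\<lambda>\<mu>. the (map_of xs \<mu>)"
  have c: "?c \<mu> = c" if "(\<mu>, c) \<in> set xs" for \<mu> c
    using map_of_is_SomeI[OF distinct that] by simp
  have "(\<Sum>(\<mu>, c)\<leftarrow>xs. c * schur \<mu> m) = (\<Sum>\<mu>\<in>fst ` set xs. ?c \<mu> * schur \<mu> m)" for m
  proof -
    have "(\<Sum>(\<mu>, c)\<leftarrow>xs. c * schur \<mu> m) = (\<Sum>(\<mu>, c)\<in>set xs. c * schur \<mu> m)"
      using distinct by (intro sum_list_distinct_conv_sum_set) (simp add: distinct_map)
    also have "\<dots> = (\<Sum>p\<in>set xs. ?c (fst p) * schur (fst p) m)"
      using c by (intro sum.cong) auto
    also have "\<dots> = (\<Sum>\<mu>\<in>fst ` set xs. ?c \<mu> * schur \<mu> m)"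
      using distinct by (simp add: sum.reindex distinct_map)
    finally show ?thesis .
  qed
  with positive have "schur_positive (\<lambda>m. \<Sum>\<mu>\<in>fst ` set xs. ?c \<mu> * schur \<mu> m)" by simp
  then have "?c \<mu> \<ge> 0"
  proof (rule schur_positive_coeff_nonneg[rotated 2])
    show "is_partition \<nu>" if "\<nu> \<in> fst ` set xs" for \<nu> using that part by auto
    show "\<mu> \<in> fst ` set xs" using mem by force
  qed simp
  then show ?thesis using c[OF mem] by simp
qed

lemma not_schur_positive_blown_up_fork:
  assumes "k \<ge> 1"
  shows "\<not> schur_positive (chromatic_sym (blown_up_fork k))"
proof
  assume "schur_positive (chromatic_sym (blown_up_fork k))"
  then have "schur_positive (\<lambda>m. \<Sum>(\<mu>, c)\<leftarrow>fork_expansion k. c * schur \<mu> m)"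
    by (simp flip: chromatic_sym_blown_up_fork_schur[OF assms])
  moreover have "(replicate 3 2 @ replicate (k - 1) 1, - 2 * fact (k + 1)) \<in> set (fork_expansion k)"
    by (simp only: fork_expansion_def list.set insert_iff simp_thms)
  ultimately have "- 2 * fact (k + 1) \<ge> (0 :: rat)"
    using schur_positive_list_coeff_nonneg[OF distinct_fork_expansion[OF assms]]
      fork_expansion_partition(1)[OF assms] by blast
  then show False using fact_gt_zero[of "k + 1", where 'a = rat] by linarith
qed

theorem theorem4p1:
  fixes k :: nat
  assumes "k \<ge> 1"
  shows "(chromatic_sym (replace_by_clique fork_graph fork_w k) = (\<lambda>m.
             fact (k + 1) * schur ([3, 2] @ replicate k 1) m
           + (of_nat k + 3) * fact (k + 1) * schur ([3] @ replicate (k + 2) 1) m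
           - 2 * fact (k + 1) * schur (replicate 3 2 @ replicate (k - 1) 1) m
           + 5 * (of_nat k + 1) * fact (k + 1) * schur (replicate 2 2 @ replicate (k + 1) 1) m
           + (of_nat k ^ 3 + 5 * of_nat k ^ 2 + 14 * of_nat k + 14) * fact (k + 1)
               * schur ([2] @ replicate (k + 3) 1) m
           + 2 * (of_nat k + 2) ^ 3 * fact (k + 1) * schur (replicate (k + 5) 1) m))
    \<and> \<not> schur_positive (chromatic_sym (replace_by_clique fork_graph fork_w k))"
proof -
  have "chromatic_sym (blown_up_fork k) = (\<lambda>m. \<Sum>(\<mu>, c)\<leftarrow>fork_expansion k. c * schur \<mu> m)"
    using chromatic_sym_blown_up_fork_schur[OF assms] by (rule ext)
  then show ?thesis
    using not_schur_positive_blown_up_fork[OF assms]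
    by (simp add: fork_expansion_def algebra_simps del: fact_Suc)
qed

end
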